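(* Let $\mathcal{T}=\mathcal{T}(O)$ be a self-similar tiling generated on a feasible open set $O$ of an IFS in $\mathbb{R}^d$ with contraction ratios $r_1,\dots,r_N$ and similarity dimension $D$, such that the generator $G$ satisfies $\dim_M(\partial G,G)<D$. Then the average Minkowski content of $\mathcal{T}$ is determined completely in terms of the volume function $V(G,\varepsilon)$ of $G$ via the formula $$\widetilde{\mathcal{M}}^D(\mathcal{T})=\frac1\eta\int_0^\infty\varepsilon^{D-d-1}V(G,\varepsilon)\,d\varepsilon ,\qquad \eta=-\sum_{i=1}^N r_i^D\ln r_i .$$ In the nonlattice case, also the Minkowski content $\mathcal{M}^D(\mathcal{T})$ of $\mathcal{T}$ is given by the right-hand side.
   Context: Setting. $N\ge2$, $S_1,\dots,S_N:\mathbb{R}^d\to\mathbb{R}^d$ are contracting similarities with ratios $r_i\in(0,1)$ (an IFS), and $\mathbf{S}(A):=\bigcup_{i=1}^N S_i(A)$. The similarity dimension $D$ is the unique real solution of $\sum_{i=1}^N r_i^D=1$. A feasible open set for the IFS is a nonempty bounded open set $O\subset\mathbb{R}^d$ with $S_iO\subset O$ for all $i$ and $S_iO\cap S_jO=\emptyset$ for $i\ne j$. The nonlattice case is the one where the additive subgroup of $\mathbb{R}$ generated by $\ln r_1,\dots,\ln r_N$ is not discrete. Tilings. Let $\Sigma_N^*=\bigcup_{n\ge0}\{1,\dots,N\}^n$, and for $\sigma=\sigma_1\cdots\sigma_n$ put $S_\sigma:=S_{\sigma_1}\circ\dots\circ S_{\sigma_n}$ (identity for the empty word). For a feasible open set $O$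 let $K:=\overline O$ and let the generator be the open set $G:=O\setminus\mathbf{S}K$. The self-similar tiling generated on $O$ is $\mathcal{T}(O):=\{S_\sigma G:\sigma\in\Sigma_N^*\}$; its union set is $T:=\bigcup_{\sigma}S_\sigma G$. The tiling is only defined when $D<d$ (equivalently $G\neq\emptyset$), which is assumed. Minkowski contents. $\lambda_d$ is Lebesgue measure and $A_\varepsilon:=\{z:\inf_{a\in A}|a-z|\le\varepsilon\}$. For a bounded open set $U$, $V(U,\varepsilon):=\lambda_d(\{x\in U: d(x,\partial U)\le\varepsilon\})$. For bounded $A$ and $\Omega\subset\mathbb{R}^d$, $\mathcal{M}^s(A,\Omega):=\lim_{\varepsilon\searrow0}\varepsilon^{s-d}\lambda_d(A_\varepsilon\cap\Omega)$ and $\widetilde{\mathcal{M}}^s(A,\Omega):=\lim_{\delta\searrow0}\frac1{|\ln\delta|}\int_\delta^1\varepsilon^{s-d}\lambda_d(A_\varepsilon\cap\Omega)\frac{d\varepsilon}{\varepsilon}$, whenever the limits exist. $\dim_M(A,\Omega)$ is the relative Minkowski dimension, i.e. $\inf\{s\ge0:\varepsilon^{s-d}\lambda_d(A_\varepsilon\cap\Omega)\to0\text{ as }\varepsilon\searrow0\}$. For the tiling, $\mathcal{M}^D(\mathcal{T}):=\mathcal{M}^D(\partial T,T)=\lim_{\varepsilon\searrow0}\varepsilon^{D-d}V(T,\varepsilon)$ and $\widetilde{\mathcal{M}}^D(\mathcal{T}):=\widetilde{\mathcal{M}}^D(\partial T,T)$. *)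

theory Defs
  imports
    "HOL-Analysis.Analysis"
    "HOL-Computational_Algebra.Group_Closure"
begin

section \<open>Iterated function systems\<close>

definition contracting_similarity :: "('a::euclidean_space \<Rightarrow> 'a) \<Rightarrow> real \<Rightarrow> bool" where
  "contracting_similarity f c \<longleftrightarrow>
     0 < c \<and> c < 1 \<and> (\<forall>x y. dist (f x) (f y) = c * dist x y)"

definition ifs :: "nat \<Rightarrow> (nat \<Rightarrow> 'a::euclidean_space \<Rightarrow> 'a) \<Rightarrow> (nat \<Rightarrow> real) \<Rightarrow> bool" where
  "ifs N S r \<longleftrightarrow> 2 \<le> N \<and> (\<forall>i\<in>{1..N}. contracting_similarity (S i) (r i))"

definition set_map :: "nat \<Rightarrow> (nat \<Rightarrow> 'a \<Rightarrow> 'a) \<Rightarrow> 'a set \<Rightarrow> 'a set" where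
  "set_map N S A = (\<Union>i\<in>{1..N}. S i ` A)"

definition similarity_dimension :: "nat \<Rightarrow> (nat \<Rightarrow> real) \<Rightarrow> real" where
  "similarity_dimension N r = (THE D. (\<Sum>i=1..N. r i powr D) = 1)"

lemma ex1_similarity_dimension:
  fixes N :: nat and r :: "nat \<Rightarrow> real"
  assumes "2 \<le> N" and r: "\<And>i. i \<in> {1..N} \<Longrightarrow> 0 < r i \<and> r i < 1"
  shows "\<exists>!D. (\<Sum>i=1..N. r i powr D) = (1::real)"
proof -
  define f where "f D = (\<Sum>i=1..N. r i powr D)" for D
  have dec: "f y < f x" if "x < y" for x y
    unfolding f_def
    using assms that by (intro sum_strict_mono) (auto intro!: powr_less_mono')
  have "((\<lambda>D. \<Sum>i=1..N. r i powr D) \<longlongrightarrow> (\<Sum>i=1..N. 0)) at_top"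
  proof (rule tendsto_sum)
    fix i assume "i \<in> {1..N}"
    then have "0 < r i" "r i < 1" using r by auto
    have "((\<lambda>D. exp (D * ln (r i))) \<longlongrightarrow> 0) at_top"
      by (rule filterlim_compose[OF exp_at_bot])
         (use \<open>0 < r i\<close> \<open>r i < 1\<close> in
           \<open>auto intro!: filterlim_tendsto_neg_mult_at_bot[OF tendsto_const _ filterlim_ident]
                 simp: mult.commute[of _ "ln (r i)"]\<close>)
    then show "((\<lambda>D. r i powr D) \<longlongrightarrow> 0) at_top"
      using \<open>0 < r i\<close> by (simp add: powr_def)
  qed
  then have "(f \<longlongrightarrow> 0) at_top" by (simp add: f_def[abs_def])
  then have "eventually (\<lambda>D. f D < 1) at_top" by (rule order_tendstoD) simp
  then obtain b where b: "f b < 1" "b \<ge> 0"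
    by (metis eventually_at_top_linorder le_cases)
  have "f 0 = real N"
    unfolding f_def using r by (subst sum.cong[OF refl, of _ _ "\<lambda>_. 1"]) force+
  then have "f b \<le> 1" "1 \<le> f 0" using b \<open>2 \<le> N\<close> by auto
  moreover have "\<forall>x. 0 \<le> x \<and> x \<le> b \<longrightarrow> isCont f x"
    unfolding f_def[abs_def] using r by (force intro!: continuous_intros)
  ultimately obtain D where "f D = 1" using IVT2[of f b 1 0] b by blast
  moreover have "D' = D" if "f D' = 1" for D'
    using dec[of D D'] dec[of D' D] that \<open>f D = 1\<close> by (cases D D' rule: linorder_cases) auto
  ultimately show ?thesis unfolding f_def by blast
qed

definition nonlattice :: "nat \<Rightarrow> (nat \<Rightarrow> real) \<Rightarrow> bool" where
  "nonlattice N r \<longleftrightarrow> \<not> discrete (group_closure ((\<lambda>i. ln (r i)) ` {1..N}))"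

definition feasible_open_set ::
  "nat \<Rightarrow> (nat \<Rightarrow> 'a::euclidean_space \<Rightarrow> 'a) \<Rightarrow> 'a set \<Rightarrow> bool" where
  "feasible_open_set N S U \<longleftrightarrow>
     U \<noteq> {} \<and> bounded U \<and> open U \<and>
     (\<forall>i\<in>{1..N}. S i ` U \<subseteq> U) \<and>
     (\<forall>i\<in>{1..N}. \<forall>j\<in>{1..N}. i \<noteq> j \<longrightarrow> S i ` U \<inter> S j ` U = {})"


section \<open>Self-similar tilings\<close>

fun word_map :: "(nat \<Rightarrow> 'a \<Rightarrow> 'a) \<Rightarrow> nat list \<Rightarrow> 'a \<Rightarrow> 'a" where
  "word_map S [] = id"
| "word_map S (i # w) = S i \<circ> word_map S w"

definition generator ::
  "nat \<Rightarrow> (nat \<Rightarrow> 'a::euclidean_space \<Rightarrow> 'a) \<Rightarrow> 'a set \<Rightarrow> 'a set" where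
  "generator N S U = U - set_map N S (closure U)"

definition tiling ::
  "nat \<Rightarrow> (nat \<Rightarrow> 'a::euclidean_space \<Rightarrow> 'a) \<Rightarrow> 'a set \<Rightarrow> 'a set set" where
  "tiling N S U = {word_map S w ` generator N S U | w. w \<in> lists {1..N}}"


section \<open>Minkowski contents\<close>

text \<open>The guard \<open>A \<noteq> {}\<close> implements the convention that the infimum of the empty set
  is infinite, whereas the library sets \<open>infdist x {} = 0\<close>.\<close>

definition parallel_set :: "'a::euclidean_space set \<Rightarrow> real \<Rightarrow> 'a set" where
  "parallel_set A \<epsilon> = {z. A \<noteq> {} \<and> infdist z A \<le> \<epsilon>}"

definition tube_volume :: "'a::euclidean_space set \<Rightarrow> real \<Rightarrow> real" where
  "tube_volume U \<epsilon> = measure lebesgue {x \<in> U. infdist x (frontier U) \<le> \<epsilon>}"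

text \<open>In the following, \<open>A\<close> and \<open>\<Omega>\<close> are meant to be bounded, \<open>\<Omega>\<close> also measurable; the measures
  are then finite and, as functions of \<open>\<epsilon>\<close>, monotone, so that the integrals exist.
  Existence of a content is part of the two predicates.\<close>

definition has_minkowski_content ::
  "real \<Rightarrow> 'a::euclidean_space set \<Rightarrow> 'a set \<Rightarrow> real \<Rightarrow> bool" where
  "has_minkowski_content s A \<Omega> c \<longleftrightarrow>
     ((\<lambda>\<epsilon>. \<epsilon> powr (s - DIM('a)) * measure lebesgue (parallel_set A \<epsilon> \<inter> \<Omega>)) \<longlongrightarrow> c) (at_right 0)"

definition has_average_minkowski_content ::
  "real \<Rightarrow> 'a::euclidean_space set \<Rightarrow> 'a set \<Rightarrow> real \<Rightarrow> bool" where
  "has_average_minkowski_content s A \<Omega> c \<longleftrightarrow>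
     ((\<lambda>\<delta>. 1 / \<bar>ln \<delta>\<bar> *
        (LINT \<epsilon>:{\<delta>..1}|lborel.
           \<epsilon> powr (s - DIM('a)) * measure lebesgue (parallel_set A \<epsilon> \<inter> \<Omega>) / \<epsilon>)) \<longlongrightarrow> c) (at_right 0)"

definition minkowski_dim :: "'a::euclidean_space set \<Rightarrow> 'a set \<Rightarrow> real" where
  "minkowski_dim A \<Omega> = Inf {s. 0 \<le> s \<and> has_minkowski_content s A \<Omega> 0}"

definition tiling_has_minkowski_content :: "real \<Rightarrow> 'a::euclidean_space set set \<Rightarrow> real \<Rightarrow> bool" where
  "tiling_has_minkowski_content D \<T> c \<longleftrightarrow>
     has_minkowski_content D (frontier (\<Union>\<T>)) (\<Union>\<T>) c"

definition tiling_has_average_minkowski_content ::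
  "real \<Rightarrow> 'a::euclidean_space set set \<Rightarrow> real \<Rightarrow> bool" where
  "tiling_has_average_minkowski_content D \<T> c \<longleftrightarrow>
     has_average_minkowski_content D (frontier (\<Union>\<T>)) (\<Union>\<T>) c"

end

theory Submission
  imports Defs
begin

text \<open>
  Write \<open>T\<close> for the union of the tiles, \<open>V\<close> and \<open>W\<close> for the tube volumes of \<open>T\<close> and of the generator
  \<open>G\<close>, and \<open>d\<close> for the dimension of the space. The set \<open>T\<close> is the disjoint union of the open sets \<open>G\<close>
  and \<open>S\<^sub>i T\<close>. A closed ball is connected, so it lies in \<open>T\<close> iff it lies in one of these pieces; hence
  tube volumes add up over the pieces, and the scaling of volume under similarities gives
  \<open>V \<epsilon> = W \<epsilon> + (\<Sum>i. r\<^sub>i ^ d * V (\<epsilon> / r\<^sub>i))\<close> (\<open>tube_volume_tiling\<close>).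

  In logarithmic scale this is a renewal equation. The function
  \<open>Z t = exp (- (D - d) * t) * V (exp (- t))\<close> satisfies
  \<open>Z t - (\<Sum>i. p\<^sub>i * Z (t - y\<^sub>i)) = z t\<close> with the probability weights \<open>p\<^sub>i = r\<^sub>i powr D\<close>, the steps
  \<open>y\<^sub>i = - ln r\<^sub>i\<close>, and \<open>z\<close> the corresponding function of \<open>W\<close>; the mean step is \<open>\<eta>\<close>. The contents in
  question are the limit of \<open>Z\<close> and the limit of its averages. Let \<open>a t\<close> be the integral of \<open>Z\<close> over
  \<open>{..t}\<close>. Integrating the equation gives
  \<open>(\<Sum>i. p\<^sub>i * (a t - a (t - y\<^sub>i))) = integral of z over {..t}\<close>,
  which converges to the integral \<open>L\<close> of \<open>z\<close>. The bound on the dimension of the frontier makes \<open>z\<close>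
  decay exponentially, so \<open>L\<close> is finite.

  Two statements about such equations finish the proof. The difference of \<open>a t\<close> and \<open>L / \<eta> * t\<close>
  satisfies a renewal equation with vanishing right-hand side, so it grows sublinearly
  (\<open>mean_renewal\<close>); this is the average content. For the limit of \<open>Z\<close> itself, follow a sequence along
  which \<open>Z\<close> approaches its limit superior \<open>M\<close>. As \<open>Z t\<close> is, up to \<open>o(1)\<close>, an average of the
  \<open>Z (t - y\<^sub>i)\<close>, none of which can exceed \<open>M\<close> by much, all of them are close to \<open>M\<close> as well, and so are
  the \<open>Z (t - w)\<close> for every \<open>w\<close> in the additive monoid generated by the steps. In the nonlattice case this
  monoid contains arbitrarily fine progressions of any length. Since \<open>V\<close> is monotone, \<open>Z\<close> cannot drop
  quickly to the left, so \<open>Z\<close> is nearly \<open>\<ge> M\<close> on a whole window, and \<open>L \<ge> \<eta> * M\<close> by the integrated equation.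
  Symmetrically \<open>L \<le> \<eta> * m\<close> for the limit inferior \<open>m\<close>, and both equal \<open>L / \<eta>\<close>
  (\<open>key_renewal\<close>).
\<close>

section \<open>Renewal equations with finitely many steps\<close>

locale renewal_weights =
  fixes J :: "'i set" and p y :: "'i \<Rightarrow> real"
  assumes finite_J: "finite J"
    and p_pos: "\<And>i. i \<in> J \<Longrightarrow> 0 < p i"
    and sum_p: "(\<Sum>i\<in>J. p i) = 1"
    and y_pos: "\<And>i. i \<in> J \<Longrightarrow> 0 < y i"
begin

text \<open>The right-hand side of the renewal equation solved by \<open>f\<close>: the amount by which \<open>f\<close> fails to be
  harmonic for the random walk with step distribution \<open>p\<close>.\<close>

definition defect :: "(real \<Rightarrow> real) \<Rightarrow> real \<Rightarrow> real" where
  "defect f t = f t - (\<Sum>i\<in>J. p i * f (t - y i))"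

definition mean_step :: real where
  "mean_step = (\<Sum>i\<in>J. p i * y i)"

lemma J_nonempty: "J \<noteq> {}"
  using sum_p by auto

lemma mean_step_pos: "0 < mean_step"
  unfolding mean_step_def using finite_J J_nonempty p_pos y_pos
  by (intro sum_pos) auto

lemma defect_eq_increments: "defect f t = (\<Sum>i\<in>J. p i * (f t - f (t - y i)))"
proof -
  have "(\<Sum>i\<in>J. p i * (f t - f (t - y i))) = (\<Sum>i\<in>J. p i) * f t - (\<Sum>i\<in>J. p i * f (t - y i))"
    by (simp add: algebra_simps sum_subtractf sum_distrib_left)
  then show ?thesis by (simp add: defect_def sum_p)
qed

lemma defect_linear_shift: "defect (\<lambda>t. f t - b * t) t = defect f t - b * mean_step"
  by (simp add: defect_eq_increments mean_step_def algebra_simps sum_subtractf sum.distrib sum_distrib_left)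

lemma defect_uminus: "defect (\<lambda>t. - f t) t = - defect f t"
  by (simp add: defect_def sum_negf)

text \<open>If the defect is at most \<open>\<epsilon> * m\<close> from \<open>T\<close> on, where \<open>m\<close> is the shortest step, then each
  step lowers the argument by at least \<open>m\<close> and costs at most \<open>\<epsilon> * m\<close>. Going back to the initial
  window therefore costs at most \<open>\<epsilon>\<close> per unit of length.\<close>

lemma sublinear_if_defect_tendsto_0:
  assumes def0: "(defect \<psi> \<longlongrightarrow> 0) at_top"
    and bdd: "\<And>s t. bounded (\<psi> ` {s..t})"
  shows "((\<lambda>t. \<psi> t / t) \<longlongrightarrow> 0) at_top"
proof (rule tendstoI)
  fix \<epsilon>' :: real assume "\<epsilon>' > 0"
  define \<epsilon> where "\<epsilon> = \<epsilon>' / 2"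
  have "\<epsilon> > 0" using \<open>\<epsilon>' > 0\<close> by (simp add: \<epsilon>_def)
  define m M where "m = Min (y ` J)" and "M = Max (y ` J)"
  have m: "m > 0" and mM: "\<And>i. i \<in> J \<Longrightarrow> m \<le> y i \<and> y i \<le> M"
    using finite_J J_nonempty y_pos by (auto simp: m_def M_def)
  have "eventually (\<lambda>t. \<bar>defect \<psi> t\<bar> \<le> \<epsilon> * m) at_top"
    using tendstoD[OF def0, of "\<epsilon> * m"] \<open>\<epsilon> > 0\<close> m by (auto elim!: eventually_mono)
  then obtain T where T: "\<And>t. t \<ge> T \<Longrightarrow> \<bar>defect \<psi> t\<bar> \<le> \<epsilon> * m"
    by (auto simp: eventually_at_top_linorder)
  obtain C where C: "\<And>t. t \<in> {T - M..T} \<Longrightarrow> \<bar>\<psi> t\<bar> \<le> C"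
    using bdd[of "T - M" T] by (force simp: bounded_iff)
  \<comment> \<open>The window \<open>{T - M..T}\<close>, \<open>M\<close> the longest step, is where a backward walk from the right first falls below \<open>T\<close>.
    The bound is linear with slope \<open>\<epsilon>\<close> and propagates by intervals of length \<open>m\<close>.\<close>
  have bound: "\<bar>\<psi> t\<bar> \<le> C + \<epsilon> * (t - T + M)" if "T - M \<le> t" "t \<le> T + real n * m" for t n
    using that
  proof (induction n arbitrary: t)
    case 0
    then show ?case using C[of t] \<open>\<epsilon> > 0\<close> by (smt (verit) atLeastAtMost_iff mult_nonneg_nonneg mult_eq_0_iff of_nat_0)
  next
    case (Suc n)
    show ?case
    proof (cases "t \<le> T + real n * m")
      case True
      then show ?thesis using Suc by blast
    next
      case False
      then have "t \<ge> T" using m by (smt (verit) mult_nonneg_nonneg of_nat_0_le_iff)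
      have "\<bar>\<psi> (t - y i)\<bar> \<le> C + \<epsilon> * (t - m - T + M)" if i: "i \<in> J" for i
      proof -
        have "\<bar>\<psi> (t - y i)\<bar> \<le> C + \<epsilon> * (t - y i - T + M)"
          using Suc.prems(2) \<open>t \<ge> T\<close> mM[OF i] by (intro Suc.IH) (auto simp: algebra_simps)
        also have "\<dots> \<le> C + \<epsilon> * (t - m - T + M)"
          using mM[OF i] \<open>\<epsilon> > 0\<close> by (auto intro!: mult_left_mono)
        finally show ?thesis .
      qed
      then have "(\<Sum>i\<in>J. p i * \<bar>\<psi> (t - y i)\<bar>) \<le> (\<Sum>i\<in>J. p i * (C + \<epsilon> * (t - m - T + M)))"
        using p_pos by (intro sum_mono mult_left_mono) (auto intro: less_imp_le)
      also have "\<dots> = C + \<epsilon> * (t - m - T + M)"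
        by (simp add: sum_p flip: sum_distrib_right)
      finally have *: "(\<Sum>i\<in>J. p i * \<bar>\<psi> (t - y i)\<bar>) \<le> C + \<epsilon> * (t - m - T + M)" .
      have "\<bar>\<Sum>i\<in>J. p i * \<psi> (t - y i)\<bar> \<le> (\<Sum>i\<in>J. p i * \<bar>\<psi> (t - y i)\<bar>)"
        using p_pos by (intro order_trans[OF sum_abs] sum_mono) (auto simp: abs_mult less_imp_le)
      then show ?thesis
        using * T[OF \<open>t \<ge> T\<close>] unfolding defect_def by (auto simp: algebra_simps)
    qed
  qed
  have "((\<lambda>t. (\<bar>C\<bar> + \<epsilon> * \<bar>M - T\<bar>) / t) \<longlongrightarrow> 0) at_top"
    by (intro tendsto_divide_0[OF tendsto_const] filterlim_at_top_imp_at_infinity filterlim_ident)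
  then have "eventually (\<lambda>t. (\<bar>C\<bar> + \<epsilon> * \<bar>M - T\<bar>) / t < \<epsilon>) at_top"
    using \<open>\<epsilon> > 0\<close> by (rule order_tendstoD)
  with eventually_gt_at_top[of 0] eventually_ge_at_top[of "T - M"]
  show "eventually (\<lambda>t. dist (\<psi> t / t) 0 < \<epsilon>') at_top"
  proof eventually_elim
    case (elim t)
    obtain n :: nat where "(t - T) / m \<le> real n" using real_arch_simple by blast
    then have "t \<le> T + real n * m" using m by (simp add: field_simps)
    then have "\<bar>\<psi> t\<bar> \<le> C + \<epsilon> * (t - T + M)" using bound elim by blast
    also have "\<dots> \<le> \<bar>C\<bar> + \<epsilon> * \<bar>M - T\<bar> + \<epsilon> * t"
      using mult_left_mono[OF abs_ge_self[of "M - T"], of \<epsilon>] \<open>\<epsilon> > 0\<close> abs_ge_self[of C] by (simp add: right_diff_distrib distrib_left)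
    also have "\<dots> < \<epsilon> * t + \<epsilon> * t" using elim by (simp add: field_simps)
    finally show ?case using elim by (simp add: \<epsilon>_def field_simps)
  qed
qed

text \<open>The defect of the function \<open>b * t\<close> is the constant \<open>b * mean_step\<close>, so \<open>L / mean_step\<close> is the
  slope for which subtracting a linear function leaves a vanishing defect.\<close>

theorem mean_renewal:
  assumes lim: "(defect a \<longlongrightarrow> L) at_top"
    and bdd: "\<And>s t. bounded (a ` {s..t})"
  shows "((\<lambda>t. a t / t) \<longlongrightarrow> L / mean_step) at_top"
proof -
  define \<psi> where "\<psi> t = a t - L / mean_step * t" for t
  have "defect \<psi> = (\<lambda>t. defect a t - L)"
    using mean_step_pos defect_linear_shift[of a "L / mean_step"]
    by (simp add: \<psi>_def[abs_def] fun_eq_iff)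
  then have "(defect \<psi> \<longlongrightarrow> 0) at_top"
    using tendsto_diff[OF lim tendsto_const[of L]] by simp
  moreover have "bounded (\<psi> ` {s..t})" for s t
    unfolding \<psi>_def
    by (intro bounded_minus_comp bdd bounded_linear_image[of "{s..t}" "\<lambda>x. L / mean_step * x"]
        bounded_linear_mult_right) simp
  ultimately have "((\<lambda>t. \<psi> t / t) \<longlongrightarrow> 0) at_top"
    by (rule sublinear_if_defect_tendsto_0)
  from tendsto_add[OF this tendsto_const[of "L / mean_step"]]
  have "((\<lambda>t. \<psi> t / t + L / mean_step) \<longlongrightarrow> L / mean_step) at_top" by simp
  then show ?thesis
    by (rule Lim_transform_eventually)
      (use eventually_gt_at_top[of 0] in eventually_elim, simp add: \<psi>_def field_simps)
qed

text \<open>A value close to the asymptotic maximum is a weighted mean of the values one step back. None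
  of these exceeds the maximum by much, so each with positive weight must be close to it.\<close>

lemma limsup_propagates_step:
  assumes top: "filterlim \<tau> at_top F"
    and lim: "((\<lambda>n. f (\<tau> n)) \<longlongrightarrow> M) F"
    and upper: "\<And>\<epsilon>. \<epsilon> > 0 \<Longrightarrow> eventually (\<lambda>t. f t \<le> M + \<epsilon>) at_top"
    and def0: "(defect f \<longlongrightarrow> 0) at_top"
    and j: "j \<in> J"
  shows "((\<lambda>n. f (\<tau> n - y j)) \<longlongrightarrow> M) F"
proof (rule tendstoI)
  fix \<epsilon>' :: real assume "\<epsilon>' > 0"
  \<comment> \<open>Three error terms of size \<open>\<epsilon>\<close> get divided by the weight \<open>p j\<close> in the end.\<close>
  define \<epsilon> where "\<epsilon> = min (\<epsilon>' / 2) (p j * \<epsilon>' / 4)"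
  have "\<epsilon> > 0" "\<epsilon> < \<epsilon>'" and \<epsilon>: "4 * \<epsilon> \<le> p j * \<epsilon>'"
    using \<open>\<epsilon>' > 0\<close> p_pos[OF j] by (auto simp: \<epsilon>_def)
  have shift: "filterlim (\<lambda>n. \<tau> n - c) at_top F" for c
    using filterlim_tendsto_add_at_top[OF tendsto_const[of "-c"] top] by (simp add: add.commute)
  have "eventually (\<lambda>n. \<forall>i\<in>J. f (\<tau> n - y i) \<le> M + \<epsilon>) F"
    unfolding eventually_ball_finite_distrib[OF finite_J]
    using eventually_compose_filterlim[OF upper[OF \<open>\<epsilon> > 0\<close>] shift] by blast
  moreover have "eventually (\<lambda>n. M - \<epsilon> < f (\<tau> n)) F"
    using lim \<open>\<epsilon> > 0\<close> by (intro order_tendstoD) auto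
  moreover have "eventually (\<lambda>n. defect f (\<tau> n) < \<epsilon>) F"
    using eventually_compose_filterlim[OF order_tendstoD(2)[OF def0 \<open>\<epsilon> > 0\<close>] top] .
  ultimately show "eventually (\<lambda>n. dist (f (\<tau> n - y j)) M < \<epsilon>') F"
  proof eventually_elim
    case (elim n)
    have "(\<Sum>i\<in>J - {j}. p i * f (\<tau> n - y i)) \<le> (\<Sum>i\<in>J - {j}. p i * (M + \<epsilon>))"
      using elim p_pos by (intro sum_mono mult_left_mono) (auto intro: less_imp_le)
    also have "\<dots> = (1 - p j) * (M + \<epsilon>)"
      using sum_p j finite_J by (simp add: sum_diff1 flip: sum_distrib_right)
    finally have "p j * f (\<tau> n - y j) \<ge> f (\<tau> n) - defect f (\<tau> n) - (1 - p j) * (M + \<epsilon>)"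
      using finite_J j by (simp add: defect_def sum.remove[of J j])
    then have "p j * f (\<tau> n - y j) > p j * M - 3 * \<epsilon> + p j * \<epsilon>"
      using elim by (simp add: algebra_simps)
    moreover have "p j * \<epsilon> > 0" using p_pos[OF j] \<open>\<epsilon> > 0\<close> by simp
    ultimately have "p j * (f (\<tau> n - y j) - M) > p j * (- \<epsilon>')"
      using \<epsilon> \<open>\<epsilon> > 0\<close> by (simp add: algebra_simps)
    then have "f (\<tau> n - y j) - M > - \<epsilon>'"
      using p_pos[OF j] by (simp only: mult_less_cancel_left_pos)
    moreover have "f (\<tau> n - y j) - M < \<epsilon>'" using elim j \<open>\<epsilon> < \<epsilon>'\<close> by force
    ultimately show ?case by (simp add: dist_real_def abs_if)
  qed
qed

inductive_set step_sums :: "real set" where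
  zero: "0 \<in> step_sums"
| step: "w \<in> step_sums \<Longrightarrow> j \<in> J \<Longrightarrow> w + y j \<in> step_sums"

lemma step_sums_add: "v \<in> step_sums \<Longrightarrow> w \<in> step_sums \<Longrightarrow> v + w \<in> step_sums"
proof (induction rule: step_sums.induct)
  case (step v j)
  then have "v + w + y j \<in> step_sums" by (intro step_sums.step)
  then show ?case by (simp add: algebra_simps)
qed simp

lemma step_sums_mult_nat: "w \<in> step_sums \<Longrightarrow> real k * w \<in> step_sums"
  by (induction k) (auto simp: algebra_simps intro: step_sums.zero step_sums_add)

lemma limsup_propagates:
  assumes top: "filterlim \<tau> at_top F"
    and lim: "((\<lambda>n. f (\<tau> n)) \<longlongrightarrow> M) F"
    and upper: "\<And>\<epsilon>. \<epsilon> > 0 \<Longrightarrow> eventually (\<lambda>t. f t \<le> M + \<epsilon>) at_top"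
    and def0: "(defect f \<longlongrightarrow> 0) at_top"
    and w: "w \<in> step_sums"
  shows "((\<lambda>n. f (\<tau> n - w)) \<longlongrightarrow> M) F"
  using w
proof induction
  case zero
  then show ?case using lim by simp
next
  case (step w j)
  have "filterlim (\<lambda>n. \<tau> n - w) at_top F"
    using filterlim_tendsto_add_at_top[OF tendsto_const[of "-w"] top] by (simp add: add.commute)
  from limsup_propagates_step[OF this step.IH upper def0 step.hyps(2)]
  show ?case by (simp add: algebra_simps)
qed

end

lemma limsup_attained_along_sequence:
  fixes f :: "real \<Rightarrow> real"
  assumes ub: "eventually (\<lambda>t. f t \<le> B) at_top" and lb: "eventually (\<lambda>t. b \<le> f t) at_top"
  obtains M \<tau> where "filterlim \<tau> at_top sequentially" "(\<lambda>n. f (\<tau> n)) \<longlonglongrightarrow> M"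
    "\<And>\<epsilon>. \<epsilon> > 0 \<Longrightarrow> eventually (\<lambda>t. f t \<le> M + \<epsilon>) at_top"
proof -
  define X where "X = {B. eventually (\<lambda>t. f t \<le> B) at_top}"
  define M where "M = Inf X"
  have "b \<le> C" if "C \<in> X" for C
  proof -
    from that have "eventually (\<lambda>t. f t \<le> C) at_top" by (simp add: X_def)
    with lb have "eventually (\<lambda>t::real. b \<le> C) at_top" by eventually_elim simp
    then show ?thesis by simp
  qed
  then have X: "X \<noteq> {}" "bdd_below X" using ub by (auto simp: X_def intro!: bdd_belowI[of _ b])
  have upper: "eventually (\<lambda>t. f t \<le> M + \<epsilon>) at_top" if "\<epsilon> > 0" for \<epsilon>
  proof -
    obtain C where "C \<in> X" "C < M + \<epsilon>"
      using cInf_lessD[OF X(1), of "M + \<epsilon>"] \<open>\<epsilon> > 0\<close> unfolding M_def by force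
    then show ?thesis by (auto simp: X_def elim!: eventually_mono)
  qed
  have "\<exists>t\<ge>T. M - \<epsilon> < f t" if "\<epsilon> > 0" for \<epsilon> T
  proof (rule ccontr)
    assume "\<not> ?thesis"
    then have "\<forall>t\<ge>T. f t \<le> M - \<epsilon>" by (auto simp: not_less)
    then have "M - \<epsilon> \<in> X"
      unfolding X_def eventually_at_top_linorder by auto
    then have "M \<le> M - \<epsilon>" unfolding M_def using X(2) by (intro cInf_lower)
    then show False using that by simp
  qed
  then have "\<forall>n::nat. \<exists>t. t \<ge> real n \<and> M - 1 / real (Suc n) < f t" by force
  then obtain \<tau> where \<tau>: "\<And>n. \<tau> n \<ge> real n" "\<And>n. M - 1 / real (Suc n) < f (\<tau> n)" by metis
  have top: "filterlim \<tau> at_top sequentially"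
    using \<tau>(1) by (intro filterlim_at_top_mono[OF filterlim_real_sequentially]) auto
  have "(\<lambda>n. f (\<tau> n)) \<longlonglongrightarrow> M"
  proof (rule tendstoI)
    fix \<epsilon> :: real assume "\<epsilon> > 0"
    have "eventually (\<lambda>n. 1 / real (Suc n) < \<epsilon>) sequentially"
      using order_tendstoD(2)[OF LIMSEQ_inverse_real_of_nat \<open>\<epsilon> > 0\<close>] by (simp add: inverse_eq_divide)
    moreover have "eventually (\<lambda>n. f (\<tau> n) \<le> M + \<epsilon> / 2) sequentially"
      using eventually_compose_filterlim[OF upper[of "\<epsilon>/2"] top] \<open>\<epsilon> > 0\<close> by simp
    ultimately show "eventually (\<lambda>n. dist (f (\<tau> n)) M < \<epsilon>) sequentially"
    proof eventually_elim
      case (elim n)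
      then show ?case using \<tau>(2)[of n] \<open>\<epsilon> > 0\<close> unfolding dist_real_def by linarith
    qed
  qed
  then show ?thesis using that top upper by blast
qed

context renewal_weights
begin

text \<open>The only link between \<open>a\<close> and \<open>Z\<close> that the proof uses is that increments of \<open>a\<close> lie between
  the extreme values of \<open>Z\<close> times the length of the interval, as holds for a primitive of \<open>Z\<close>.
  The growth condition is the Tauberian one: it replaces uniform continuity of \<open>Z\<close>, which may jump.
  It carries lower bounds from a point to the left of it and upper bounds to the right of it.\<close>

theorem key_renewal:
  fixes Z a :: "real \<Rightarrow> real"
  assumes Z_nonneg: "\<And>t. 0 \<le> Z t"
    and c: "0 \<le> c"
    and growth: "\<And>s t. s \<le> t \<Longrightarrow> Z t \<le> exp (c * (t - s)) * Z s"
    and incr_ge: "\<And>s t K. s \<le> t \<Longrightarrow> (\<And>x. x \<in> {s..t} \<Longrightarrow> K \<le> Z x) \<Longrightarrow> K * (t - s) \<le> a t - a s"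
    and incr_le: "\<And>s t K. s \<le> t \<Longrightarrow> (\<And>x. x \<in> {s..t} \<Longrightarrow> Z x \<le> K) \<Longrightarrow> a t - a s \<le> K * (t - s)"
    and a_lim: "(defect a \<longlongrightarrow> L) at_top"
    and Z_lim: "(defect Z \<longlongrightarrow> 0) at_top"
    and dense: "\<And>\<delta>. \<delta> > 0 \<Longrightarrow> \<exists>u\<in>step_sums. \<exists>v\<in>step_sums. 0 < u - v \<and> u - v < \<delta>"
  shows "(Z \<longlongrightarrow> L / mean_step) at_top"
proof -
  define ymax where "ymax = Max (y ` J)"
  have ymax: "y i \<le> ymax" "0 < y i" if "i \<in> J" for i
    using finite_J y_pos that by (auto simp: ymax_def)
  have a_mono: "a s \<le> a t" if "s \<le> t" for s t
    using incr_ge[OF that, of 0] Z_nonneg by simp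

  \<comment> \<open>For \<open>u, v\<close> in the monoid and \<open>h = u - v\<close>, the sums of \<open>k\<close> copies of \<open>u\<close> and \<open>m - k\<close> copies of \<open>v\<close>
    form a progression of step \<open>h\<close>. It has to be longer than the longest renewal step, with one spare
    gap so that points of a window have grid neighbours on both sides.\<close>
  have grid: "\<exists>h v0. \<exists>m::nat. 0 < h \<and> h < \<delta> \<and> (\<forall>k\<le>m. v0 + real k * h \<in> step_sums) \<and> ymax + h \<le> real m * h"
    if "\<delta> > 0" for \<delta>
  proof -
    obtain u v where uv: "u \<in> step_sums" "v \<in> step_sums" "0 < u - v" "u - v < \<delta>"
      using dense[OF \<open>\<delta> > 0\<close>] by blast
    define h where "h = u - v"
    obtain m :: nat where m: "(ymax + h) / h \<le> real m" using real_arch_simple by blast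
    have "real m * v + real k * h \<in> step_sums" if "k \<le> m" for k
    proof -
      have "real m * v + real k * h = real k * u + real (m - k) * v"
        using that by (simp add: h_def of_nat_diff algebra_simps)
      then show ?thesis using uv by (simp add: step_sums_add step_sums_mult_nat)
    qed
    then show ?thesis using uv m by (metis h_def pos_divide_le_eq)
  qed

  \<comment> \<open>On a window as long as the longest step, bounds on \<open>Z\<close> control the defect of \<open>a\<close>,
    which converges to \<open>L\<close>.\<close>
  have defect_ge: "K * mean_step \<le> defect a t" if "\<And>x. x \<in> {t - ymax..t} \<Longrightarrow> K \<le> Z x" for K t
  proof -
    have "K * mean_step = (\<Sum>i\<in>J. p i * (K * (t - (t - y i))))"
      by (simp add: mean_step_def sum_distrib_left mult_ac)
    also have "\<dots> \<le> defect a t"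
      unfolding defect_eq_increments using ymax that p_pos
      by (intro sum_mono mult_left_mono incr_ge) (force simp: less_imp_le)+
    finally show ?thesis .
  qed
  have defect_le: "defect a t \<le> K * mean_step" if "\<And>x. x \<in> {t - ymax..t} \<Longrightarrow> Z x \<le> K" for K t
  proof -
    have "defect a t \<le> (\<Sum>i\<in>J. p i * (K * (t - (t - y i))))"
      unfolding defect_eq_increments using ymax that p_pos
      by (intro sum_mono mult_left_mono incr_le) (force simp: less_imp_le)+
    also have "\<dots> = K * mean_step"
      by (simp add: mean_step_def sum_distrib_left mult_ac)
    finally show ?thesis .
  qed

  obtain B where B: "eventually (\<lambda>t. Z t \<le> B) at_top"
  proof -
    have "exp (- c * ymax) * Z t * mean_step \<le> defect a t" for t
    proof (rule defect_ge)
      fix x assume x: "x \<in> {t - ymax..t}"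
      have "exp (- c * ymax) * Z t \<le> exp (- c * (t - x)) * Z t"
        using x c Z_nonneg by (intro mult_right_mono) (auto intro!: mult_left_mono)
      also have "\<dots> \<le> exp (- c * (t - x)) * (exp (c * (t - x)) * Z x)"
        using x growth by (intro mult_left_mono) auto
      finally show "exp (- c * ymax) * Z t \<le> Z x"
        by (simp add: mult.assoc[symmetric] flip: exp_add)
    qed
    moreover have "eventually (\<lambda>t. defect a t < L + 1) at_top"
      using a_lim by (rule order_tendstoD) simp
    ultimately have "eventually (\<lambda>t. exp (- c * ymax) * Z t * mean_step \<le> L + 1) at_top"
      by (auto elim!: eventually_mono intro: order_trans less_imp_le)
    then have "eventually (\<lambda>t. Z t \<le> (L + 1) / (exp (- c * ymax) * mean_step)) at_top"
      using mean_step_pos by (auto elim!: eventually_mono simp: field_simps)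
    then show ?thesis using that by blast
  qed

  have shift: "filterlim (\<lambda>n. \<tau> n - w) at_top sequentially" if "filterlim \<tau> at_top sequentially" for \<tau> :: "nat \<Rightarrow> real" and w
    using filterlim_tendsto_add_at_top[OF tendsto_const[of "-w"] that] by (simp add: add.commute)

  obtain M \<tau> where M: "filterlim \<tau> at_top sequentially" "(\<lambda>n. Z (\<tau> n)) \<longlonglongrightarrow> M"
    "\<And>\<epsilon>. \<epsilon> > 0 \<Longrightarrow> eventually (\<lambda>t. Z t \<le> M + \<epsilon>) at_top"
    by (rule limsup_attained_along_sequence[OF B, of 0]) (use Z_nonneg in auto)
  \<comment> \<open>The limit superior propagates to all grid points; a point of the window lies less than \<open>h\<close> to the
    left of the grid point \<open>\<tau> n - (v0 + k * h)\<close>.\<close>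
  have M_le: "\<exists>h. 0 < h \<and> h < \<delta> \<and> exp (- c * h) * (M - \<delta>) * mean_step \<le> L" if "\<delta> > 0" for \<delta>
  proof -
    obtain h v0 and m :: nat where h: "0 < h" "h < \<delta>"
      and W: "\<And>k. k \<le> m \<Longrightarrow> v0 + real k * h \<in> step_sums" and m: "ymax + h \<le> real m * h"
      using grid[OF \<open>\<delta> > 0\<close>] by blast
    have "eventually (\<lambda>n. \<forall>k\<in>{..m}. M - \<delta> < Z (\<tau> n - (v0 + real k * h))) sequentially"
      unfolding eventually_ball_finite_distrib[OF finite_atMost] using W \<open>\<delta> > 0\<close>
      by (intro ballI order_tendstoD(1)[OF limsup_propagates[OF M Z_lim]]) auto
    then have "eventually (\<lambda>n. exp (- c * h) * (M - \<delta>) * mean_step \<le> defect a (\<tau> n - v0)) sequentially"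
    proof eventually_elim
      case (elim n)
      show ?case
      proof (rule defect_ge)
        fix x assume x: "x \<in> {\<tau> n - v0 - ymax..\<tau> n - v0}"
        define k where "k = nat \<lfloor>(\<tau> n - v0 - x) / h\<rfloor>"
        have "real k \<le> (\<tau> n - v0 - x) / h" "(\<tau> n - v0 - x) / h < real k + 1"
          using x h by (auto simp: k_def)
        then have k: "real k * h \<le> \<tau> n - v0 - x" "\<tau> n - v0 - x < real k * h + h"
          using h by (auto simp: field_simps)
        have "real k * h \<le> real m * h" using k m x h unfolding atLeastAtMost_iff by linarith
        then have "k \<le> m" using h by simp
        then have "exp (- c * h) * (M - \<delta>) \<le> exp (- c * h) * Z (\<tau> n - (v0 + real k * h))"
          using elim by (intro mult_left_mono) (auto intro: less_imp_le)
        also have "\<dots> \<le> exp (- c * h) * (exp (c * (\<tau> n - (v0 + real k * h) - x)) * Z x)"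
          using k growth by (intro mult_left_mono) auto
        also have "\<dots> \<le> exp (- c * h) * (exp (c * h) * Z x)"
          using k c Z_nonneg by (intro mult_left_mono mult_right_mono) (auto intro!: mult_left_mono)
        finally show "exp (- c * h) * (M - \<delta>) \<le> Z x"
          by (simp add: mult.assoc[symmetric] flip: exp_add)
      qed
    qed
    then have "exp (- c * h) * (M - \<delta>) * mean_step \<le> L"
      by (intro tendsto_lowerbound[OF filterlim_compose[OF a_lim shift[OF M(1)]]]) auto
    then show ?thesis using h by blast
  qed
  then have "\<forall>n::nat. \<exists>h. 0 < h \<and> h < 1 / real (Suc n) \<and> exp (- c * h) * (M - 1 / real (Suc n)) * mean_step \<le> L"
    by simp
  then obtain h where h: "\<And>n. 0 < h n" "\<And>n. h n < 1 / real (Suc n)"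
    "\<And>n. exp (- c * h n) * (M - 1 / real (Suc n)) * mean_step \<le> L" by metis
  have lim1: "(\<lambda>n. 1 / real (Suc n)) \<longlonglongrightarrow> 0"
    using LIMSEQ_inverse_real_of_nat by (simp add: inverse_eq_divide)
  have squeeze: "g \<longlonglongrightarrow> 0" if "\<And>n. 0 < g n" "\<And>n. g n < 1 / real (Suc n)" for g
    by (rule tendsto_sandwich[OF _ _ tendsto_const lim1]) (intro always_eventually allI less_imp_le that)+
  have "(\<lambda>n. exp (- c * h n) * (M - 1 / real (Suc n)) * mean_step) \<longlonglongrightarrow> exp (- c * 0) * (M - 0) * mean_step"
    by (intro tendsto_intros squeeze h lim1)
  then have "exp (- c * 0) * (M - 0) * mean_step \<le> L" by (rule LIMSEQ_le_const2) (use h in auto)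
  then have upper: "M \<le> L / mean_step" using mean_step_pos by (simp add: field_simps)

  \<comment> \<open>The limit inferior is treated as the limit superior \<open>M'\<close> of the negative; now a point of the window
    lies to the right of the grid point with index \<open>k + 1\<close>.\<close>
  obtain M' \<sigma> where M': "filterlim \<sigma> at_top sequentially" "(\<lambda>n. - Z (\<sigma> n)) \<longlonglongrightarrow> M'"
    "\<And>\<epsilon>. \<epsilon> > 0 \<Longrightarrow> eventually (\<lambda>t. - Z t \<le> M' + \<epsilon>) at_top"
    by (rule limsup_attained_along_sequence[of "\<lambda>t. - Z t" 0 "-B"]) (use B Z_nonneg in auto)
  have neg_lim: "(defect (\<lambda>t. - Z t) \<longlongrightarrow> 0) at_top"
    using tendsto_minus[OF Z_lim] by (simp add: defect_uminus[abs_def])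
  have "\<exists>h. 0 < h \<and> h < \<delta> \<and> L \<le> exp (c * h) * (- M' + \<delta>) * mean_step" if "\<delta> > 0" for \<delta>
  proof -
    obtain h v0 and m :: nat where h: "0 < h" "h < \<delta>"
      and W: "\<And>k. k \<le> m \<Longrightarrow> v0 + real k * h \<in> step_sums" and m: "ymax + h \<le> real m * h"
      using grid[OF \<open>\<delta> > 0\<close>] by blast
    have "eventually (\<lambda>n. \<forall>k\<in>{..m}. M' - \<delta> < - Z (\<sigma> n - (v0 + real k * h))) sequentially"
      unfolding eventually_ball_finite_distrib[OF finite_atMost] using W \<open>\<delta> > 0\<close>
      by (intro ballI order_tendstoD(1)[OF limsup_propagates[OF M' neg_lim]]) auto
    then have "eventually (\<lambda>n. defect a (\<sigma> n - v0) \<le> exp (c * h) * (- M' + \<delta>) * mean_step) sequentially"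
    proof eventually_elim
      case (elim n)
      show ?case
      proof (rule defect_le)
        fix x assume x: "x \<in> {\<sigma> n - v0 - ymax..\<sigma> n - v0}"
        define k where "k = nat \<lfloor>(\<sigma> n - v0 - x) / h\<rfloor>"
        have "real k \<le> (\<sigma> n - v0 - x) / h" "(\<sigma> n - v0 - x) / h < real k + 1"
          using x h by (auto simp: k_def)
        then have k: "real k * h \<le> \<sigma> n - v0 - x" "\<sigma> n - v0 - x < real (Suc k) * h"
          using h by (auto simp: field_simps)
        have "real (Suc k) * h \<le> real m * h" using k m x h unfolding atLeastAtMost_iff of_nat_Suc distrib_right by linarith
        then have "Suc k \<le> m" using h by simp
        then have le: "Z (\<sigma> n - (v0 + real (Suc k) * h)) \<le> - M' + \<delta>" using elim by force
        have "Z x \<le> exp (c * (x - (\<sigma> n - (v0 + real (Suc k) * h)))) * Z (\<sigma> n - (v0 + real (Suc k) * h))"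
          using k by (intro growth) auto
        also have "\<dots> \<le> exp (c * h) * Z (\<sigma> n - (v0 + real (Suc k) * h))"
        proof -
          have "x - (\<sigma> n - (v0 + real (Suc k) * h)) \<le> h" using k by (simp add: algebra_simps)
          then show ?thesis
            using c Z_nonneg by (intro mult_right_mono) (auto intro: mult_left_mono)
        qed
        also have "\<dots> \<le> exp (c * h) * (- M' + \<delta>)" using le by (intro mult_left_mono) auto
        finally show "Z x \<le> exp (c * h) * (- M' + \<delta>)" .
      qed
    qed
    then have "L \<le> exp (c * h) * (- M' + \<delta>) * mean_step"
      by (intro tendsto_upperbound[OF filterlim_compose[OF a_lim shift[OF M'(1)]]]) auto
    then show ?thesis using h by blast
  qed
  then have "\<forall>n::nat. \<exists>h. 0 < h \<and> h < 1 / real (Suc n) \<and> L \<le> exp (c * h) * (- M' + 1 / real (Suc n)) * mean_step"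
    by simp
  then obtain h' where h': "\<And>n. 0 < h' n" "\<And>n. h' n < 1 / real (Suc n)"
    "\<And>n. L \<le> exp (c * h' n) * (- M' + 1 / real (Suc n)) * mean_step" by metis
  have "(\<lambda>n. exp (c * h' n) * (- M' + 1 / real (Suc n)) * mean_step) \<longlonglongrightarrow> exp (c * 0) * (- M' + 0) * mean_step"
    by (intro tendsto_intros squeeze h' lim1)
  then have "L \<le> exp (c * 0) * (- M' + 0) * mean_step" by (rule LIMSEQ_le_const) (use h' in auto)
  then have lower: "L / mean_step \<le> - M'" using mean_step_pos by (simp add: field_simps)

  show ?thesis
  proof (rule tendstoI)
    fix \<epsilon> :: real assume "\<epsilon> > 0"
    then have "\<epsilon> / 2 > 0" by simp
    from M(3)[OF this] M'(3)[OF this]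
    show "eventually (\<lambda>t. dist (Z t) (L / mean_step) < \<epsilon>) at_top"
    proof eventually_elim
      case (elim t)
      then show ?case using upper lower \<open>\<epsilon> > 0\<close> unfolding dist_real_def by linarith
    qed
  qed
qed

text \<open>The group generated by the steps consists of differences of elements of the monoid, and a subgroup of
  the reals that is not discrete has elements of arbitrarily small modulus: otherwise its points would be
  uniformly separated.\<close>

lemma step_sums_differences_dense:
  assumes nondiscrete: "\<not> discrete (group_closure ((\<lambda>i. - y i) ` J))"
    and "\<delta> > 0"
  shows "\<exists>u\<in>step_sums. \<exists>v\<in>step_sums. 0 < u - v \<and> u - v < \<delta>"
proof -
  define H where "H = group_closure ((\<lambda>i. - y i) ` J)"
  have diff: "\<exists>u\<in>step_sums. \<exists>v\<in>step_sums. g = u - v" if "g \<in> H" for g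
    using that unfolding H_def
  proof induction
    case (base s)
    then consider "s = 0" | i where "i \<in> J" "s = - y i" by auto
    then show ?case
    proof cases
      case 1
      then show ?thesis using step_sums.zero by force
    next
      case 2
      then show ?thesis using step_sums.zero step_sums.step[OF step_sums.zero, of i]
        by (intro bexI[of _ 0] bexI[of _ "y i"]) auto
    qed
  next
    case (diff s t)
    then obtain u v u' v' where "u \<in> step_sums" "v \<in> step_sums" "u' \<in> step_sums" "v' \<in> step_sums"
      "s = u - v" "t = u' - v'" by blast
    then show ?case
      by (intro bexI[of _ "u + v'"] bexI[of _ "v + u'"] step_sums_add) auto
  qed
  obtain g where "g \<in> H" "0 < \<bar>g\<bar>" "\<bar>g\<bar> < \<delta>"
  proof -
    have "\<not> uniform_discrete H"
      using nondiscrete uniform_discrete_imp_discrete H_def by blast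
    then obtain g h where "g \<in> H" "h \<in> H" "dist g h < \<delta>" "g \<noteq> h"
      using \<open>\<delta> > 0\<close> unfolding uniform_discrete_def by blast
    then show ?thesis
      by (intro that[of "g - h"]) (auto simp: H_def dist_real_def intro: group_closure.diff)
  qed
  then obtain u v where uv: "u \<in> step_sums" "v \<in> step_sums" "\<bar>g\<bar> = \<bar>u - v\<bar>" "0 < \<bar>u - v\<bar>" "\<bar>u - v\<bar> < \<delta>"
    using diff by metis
  then show ?thesis by (cases "u > v") force+
qed

end


section \<open>Inner parallel sets and similarities\<close>

text \<open>The inner parallel set. Unlike the tube itself, it is compatible with disjoint unions and
  similarities by simple facts about balls, without mention of frontiers.\<close>

definition erosion :: "'a::metric_space set \<Rightarrow> real \<Rightarrow> 'a set" where
  "erosion A v = {x. cball x v \<subseteq> A}"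

lemma erosion_subset: "0 \<le> v \<Longrightarrow> erosion A v \<subseteq> A"
  by (auto simp: erosion_def)

text \<open>A ball around a point of \<open>A\<close> is connected, so it leaves \<open>A\<close> iff it meets the frontier. Boundedness
  excludes the whole space, whose frontier is empty.\<close>

lemma tube_eq_diff_erosion:
  fixes A :: "'a::euclidean_space set"
  assumes "open A" "bounded A" "0 \<le> v"
  shows "{x \<in> A. infdist x (frontier A) \<le> v} = A - erosion A v"
proof -
  have "infdist x (frontier A) \<le> v \<longleftrightarrow> \<not> cball x v \<subseteq> A" if "x \<in> A" for x
  proof
    have "frontier A \<noteq> {}"
      using \<open>x \<in> A\<close> \<open>bounded A\<close> by (metis empty_iff frontier_eq_empty not_bounded_UNIV)
    then obtain y where y: "y \<in> frontier A" "infdist x (frontier A) = dist x y"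
      using infdist_attains_inf[of "frontier A" x] by auto
    have "y \<notin> A" using y(1) \<open>open A\<close> by (simp add: frontier_def interior_open)
    moreover assume "infdist x (frontier A) \<le> v"
    ultimately show "\<not> cball x v \<subseteq> A" using y by auto
  next
    assume "\<not> cball x v \<subseteq> A"
    moreover have "x \<in> cball x v \<inter> A" using that \<open>0 \<le> v\<close> by simp
    ultimately have "cball x v \<inter> frontier A \<noteq> {}"
      by (intro connected_Int_frontier connected_cball) blast+
    then obtain y where "y \<in> frontier A" "dist x y \<le> v" by auto
    then show "infdist x (frontier A) \<le> v" by (rule infdist_le2)
  qed
  then show ?thesis by (auto simp: erosion_def)
qed

lemma open_erosion:
  fixes A :: "'a::euclidean_space set"
  assumes "open A" "bounded A" "0 \<le> v"
  shows "open (erosion A v)"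
proof -
  have "erosion A v = A \<inter> {x. v < infdist x (frontier A)} \<or> A = {}"
    using tube_eq_diff_erosion[OF assms] erosion_subset[OF assms(3), of A]
    by (simp only: set_eq_iff mem_Collect_eq Int_iff Diff_iff subset_eq) (metis not_le)
  moreover have "open {x. v < infdist x (frontier A)}"
    by (intro open_Collect_less continuous_intros)
  moreover have "erosion ({} :: 'a set) v = {}" using assms(3) by (auto simp: erosion_def)
  ultimately show ?thesis using assms(1) by auto
qed

lemma tube_volume_eq_diff_erosion:
  assumes "open A" "bounded A" "0 \<le> v"
  shows "tube_volume A v = measure lborel A - measure lborel (erosion A v)"
proof -
  have "tube_volume A v = measure lborel (A - erosion A v)"
    unfolding tube_volume_def tube_eq_diff_erosion[OF assms] 
    using open_erosion[OF assms] assms by (intro measure_completion) auto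
  also have "\<dots> = measure lborel A - measure lborel (erosion A v)"
    using assms open_erosion[OF assms] emeasure_bounded_finite[OF assms(2)]
    by (intro measure_Diff erosion_subset) auto
  finally show ?thesis .
qed

text \<open>Monotonicity is stated on all of the reals, negative arguments included; in this form it yields Borel
  measurability.\<close>

lemma mono_tube_volume:
  assumes "open A" "bounded A"
  shows "mono (tube_volume A)"
proof (rule monoI)
  fix v w :: real assume "v \<le> w"
  have tube: "{x \<in> A. infdist x (frontier A) \<le> v} \<in> lmeasurable" for v
  proof (rule bounded_set_imp_lmeasurable)
    have "closed {x. infdist x (frontier A) \<le> v}"
      by (intro closed_Collect_le continuous_intros)
    then have "A \<inter> {x. infdist x (frontier A) \<le> v} \<in> sets borel"
      using \<open>open A\<close> by auto
    then show "{x \<in> A. infdist x (frontier A) \<le> v} \<in> sets lebesgue"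
      by (simp add: Collect_conj_eq)
    show "bounded {x \<in> A. infdist x (frontier A) \<le> v}"
      using \<open>bounded A\<close> by (rule bounded_subset) auto
  qed
  show "tube_volume A v \<le> tube_volume A w"
    unfolding tube_volume_def
    by (rule measure_mono_fmeasurable[OF _ fmeasurableD[OF tube] tube]) (use \<open>v \<le> w\<close> in auto)
qed

lemma tube_volume_nonneg: "0 \<le> tube_volume A v"
  by (simp add: tube_volume_def)

lemma tube_volume_le:
  assumes "open A" "bounded A"
  shows "tube_volume A v \<le> measure lborel A"
proof -
  have "tube_volume A v \<le> tube_volume A (max v 0)"
    by (rule monoD[OF mono_tube_volume[OF assms]]) simp
  also have "\<dots> \<le> measure lborel A"
    by (subst tube_volume_eq_diff_erosion[OF assms]) auto
  finally show ?thesis .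
qed

text \<open>Up to a dilation and a translation a similarity is an orthogonal transformation; in finite
  dimension this makes it surjective.\<close>

lemma similarity_image_ball:
  fixes f :: "'a::euclidean_space \<Rightarrow> 'a"
  assumes "0 < c" and f: "\<And>x y. dist (f x) (f y) = c * dist x y"
  shows "bij f" "f ` ball x s = ball (f x) (c * s)" "f ` cball x s = cball (f x) (c * s)"
proof -
  define g where "g x = (f x - f 0) /\<^sub>R c" for x
  have "dist (g x) (g y) = dist x y" for x y
  proof -
    have "g x - g y = (f x - f y) /\<^sub>R c" by (simp add: g_def scaleR_diff_right)
    then have "dist (g x) (g y) = dist (f x) (f y) / c"
      using \<open>0 < c\<close> by (simp add: dist_norm divide_inverse mult.commute)
    then show ?thesis using f \<open>0 < c\<close> by simp
  qed
  then have "orthogonal_transformation g"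
    unfolding orthogonal_transformation_isometry by (simp add: g_def)
  then have "surj g" by (rule orthogonal_transformation_surj)
  have "surj f"
  proof (rule surjI)
    fix y
    have "g (inv g ((y - f 0) /\<^sub>R c)) = (y - f 0) /\<^sub>R c"
      using \<open>surj g\<close> by (rule surj_f_inv_f)
    then show "f (inv g ((y - f 0) /\<^sub>R c)) = y"
      using \<open>0 < c\<close> by (simp add: g_def)
  qed
  moreover have "inj f"
    by (rule injI) (metis \<open>0 < c\<close> f dist_eq_0_iff mult_eq_0_iff less_irrefl)
  ultimately show "bij f" by (simp add: bij_def)
  show "f ` ball x s = ball (f x) (c * s)"
  proof (intro equalityI subsetI)
    fix z assume "z \<in> ball (f x) (c * s)"
    moreover obtain w where "z = f w" using \<open>surj f\<close> by blast
    ultimately show "z \<in> f ` ball x s" using f \<open>0 < c\<close> by auto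
  qed (use f \<open>0 < c\<close> in auto)
  show "f ` cball x s = cball (f x) (c * s)"
  proof (intro equalityI subsetI)
    fix z assume "z \<in> cball (f x) (c * s)"
    moreover obtain w where "z = f w" using \<open>surj f\<close> by blast
    ultimately show "z \<in> f ` cball x s" using f \<open>0 < c\<close> by auto
  qed (use f \<open>0 < c\<close> in auto)
qed

lemma inv_similarity:
  fixes f :: "'a::euclidean_space \<Rightarrow> 'a"
  assumes "0 < c" and f: "\<And>x y. dist (f x) (f y) = c * dist x y"
  shows "dist (inv f x) (inv f y) = 1 / c * dist x y"
proof -
  have "surj f" using similarity_image_ball(1)[OF assms] by (simp add: bij_def)
  then show ?thesis
    using f[of "inv f x" "inv f y"] \<open>0 < c\<close> by (simp add: surj_f_inv_f)
qed

lemma similarity_image_open: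
  fixes f :: "'a::euclidean_space \<Rightarrow> 'a"
  assumes "0 < c" and f: "\<And>x y. dist (f x) (f y) = c * dist x y" and "open A"
  shows "open (f ` A)"
proof (unfold open_contains_ball, intro ballI)
  fix z assume "z \<in> f ` A"
  then obtain x where x: "x \<in> A" "z = f x" by blast
  then obtain e where e: "e > 0" "ball x e \<subseteq> A" using \<open>open A\<close> open_contains_ball by blast
  then have "ball z (c * e) \<subseteq> f ` A"
    using similarity_image_ball(2)[OF assms(1) f, of x e] x by blast
  then show "\<exists>e>0. ball z e \<subseteq> f ` A" using e \<open>0 < c\<close> by (intro exI[of _ "c * e"]) auto
qed

lemma similarity_image_erosion:
  fixes f :: "'a::euclidean_space \<Rightarrow> 'a"
  assumes "0 < c" and f: "\<And>x y. dist (f x) (f y) = c * dist x y"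
  shows "erosion (f ` A) v = f ` erosion A (v / c)"
proof -
  note ball = similarity_image_ball[OF assms]
  have "cball (f x) v \<subseteq> f ` A \<longleftrightarrow> cball x (v / c) \<subseteq> A" for x
    using ball(3)[of x "v / c"] \<open>0 < c\<close>
      inj_image_subset_iff[OF bij_is_inj[OF ball(1)], of "cball x (v / c)" A] by simp
  then have "f x \<in> erosion (f ` A) v \<longleftrightarrow> f x \<in> f ` erosion A (v / c)" for x
    using bij_is_inj[OF ball(1)] by (simp add: inj_image_mem_iff erosion_def)
  then show ?thesis using bij_is_surj[OF ball(1)] by (metis rangeI set_eqI surjD)
qed

text \<open>By Vitali's theorem \<open>A\<close> is, up to a null set, a disjoint union of balls, and balls go to balls with
  radii multiplied by \<open>c\<close>. The images of the disjoint balls are disjoint subsets of the image of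
  \<open>A\<close>, whence the lower bound.\<close>

lemma emeasure_similarity_image_ge:
  fixes f :: "'a::euclidean_space \<Rightarrow> 'a"
  assumes c: "0 < c" and f: "\<And>x y. dist (f x) (f y) = c * dist x y" and A: "open A"
  shows "ennreal (c ^ DIM('a)) * emeasure lborel A \<le> emeasure lborel (f ` A)"
proof -
  define K where "K = {(x, s). 0 < s \<and> ball x s \<subseteq> A}"
  obtain C where C: "countable C" "C \<subseteq> K"
    "pairwise (\<lambda>i j. disjnt (ball (fst i) (snd i)) (ball (fst j) (snd j))) C"
    "negligible (A - (\<Union>i\<in>C. ball (fst i) (snd i)))"
  proof (rule Vitali_covering_theorem_balls[of A K fst snd])
    fix x and d :: real assume "x \<in> A" "0 < d"
    then obtain e where "e > 0" "ball x e \<subseteq> A" using A open_contains_ball by blast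
    then show "\<exists>i. i \<in> K \<and> x \<in> ball (fst i) (snd i) \<and> snd i < d"
      using \<open>0 < d\<close> by (intro exI[of _ "(x, min e (d / 2))"]) (auto simp: K_def)
  qed blast
  define B where "B i = ball (fst i) (snd i)" for i :: "'a \<times> real"
  have inj: "inj f" using similarity_image_ball(1)[OF c f] by (rule bij_is_inj)
  have disj: "disjoint_family_on B C"
    using C(3) by (auto simp: disjoint_family_on_def pairwise_def disjnt_def B_def)
  have disj': "disjoint_family_on (\<lambda>i. f ` B i) C"
    using disj image_Int[OF inj] unfolding disjoint_family_on_def by (metis image_empty)
  have ball: "emeasure lborel (f ` B i) = ennreal (c ^ DIM('a)) * emeasure lborel (B i)" if "i \<in> C" for i
  proof -
    have "0 \<le> snd i" using that C(2) by (auto simp: K_def)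
    then show ?thesis using c
      unfolding B_def similarity_image_ball(2)[OF c f]
      by (simp add: emeasure_ball power_mult_distrib ennreal_mult' mult_ac)
  qed
  have "emeasure lborel A \<le> emeasure lborel (\<Union>i\<in>C. B i)"
  proof -
    have "open (\<Union>i\<in>C. B i)" by (auto simp: B_def)
    moreover have "(A - (\<Union>i\<in>C. B i)) \<in> null_sets lborel"
      using C(4) A \<open>open (\<Union>i\<in>C. B i)\<close> unfolding negligible_iff_null_sets B_def[symmetric]
      by (auto simp: null_sets_def)
    ultimately have "emeasure lborel ((\<Union>i\<in>C. B i) \<union> (A - (\<Union>i\<in>C. B i))) = emeasure lborel (\<Union>i\<in>C. B i)"
      by (intro emeasure_Un_null_set) auto
    moreover have "(\<Union>i\<in>C. B i) \<union> (A - (\<Union>i\<in>C. B i)) = A \<union> (\<Union>i\<in>C. B i)" by blast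
    ultimately show ?thesis
      using A \<open>open (\<Union>i\<in>C. B i)\<close> emeasure_mono[of A "A \<union> (\<Union>i\<in>C. B i)" lborel] by auto
  qed
  also have "emeasure lborel (\<Union>i\<in>C. B i) = (\<integral>\<^sup>+i. emeasure lborel (B i) \<partial>count_space C)"
    using C(1) disj by (intro emeasure_UN_countable) (auto simp: B_def[abs_def])
  finally have "ennreal (c ^ DIM('a)) * emeasure lborel A \<le>
      ennreal (c ^ DIM('a)) * (\<integral>\<^sup>+i. emeasure lborel (B i) \<partial>count_space C)"
    by (intro mult_left_mono) auto
  also have "\<dots> = (\<integral>\<^sup>+i. emeasure lborel (f ` B i) \<partial>count_space C)"
    by (subst nn_integral_cmult[symmetric]) (auto simp: ball intro!: nn_integral_cong)
  also have "\<dots> = emeasure lborel (\<Union>i\<in>C. f ` B i)"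
    using C(1) disj' similarity_image_open[OF c f]
    by (intro emeasure_UN_countable[symmetric]) (auto simp: B_def)
  also have "\<dots> \<le> emeasure lborel (f ` A)"
    using C(2) similarity_image_open[OF c f A]
    by (intro emeasure_mono UN_least image_mono) (fastforce simp: B_def K_def)+
  finally show ?thesis .
qed

text \<open>The missing upper bound is the lower bound for the inverse similarity.\<close>

lemma emeasure_similarity_image:
  fixes f :: "'a::euclidean_space \<Rightarrow> 'a"
  assumes c: "0 < c" and f: "\<And>x y. dist (f x) (f y) = c * dist x y" and A: "open A"
  shows "emeasure lborel (f ` A) = ennreal (c ^ DIM('a)) * emeasure lborel A"
proof (rule antisym)
  have bij: "bij f" by (rule similarity_image_ball[OF c f])
  have "ennreal ((1 / c) ^ DIM('a)) * emeasure lborel (f ` A) \<le> emeasure lborel (inv f ` f ` A)"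
    using c by (intro emeasure_similarity_image_ge inv_similarity f similarity_image_open[OF c f A]) auto
  then have "ennreal ((1 / c) ^ DIM('a)) * emeasure lborel (f ` A) \<le> emeasure lborel A"
    using bij by (simp add: image_inv_f_f bij_is_inj)
  then have "ennreal (c ^ DIM('a)) * (ennreal ((1 / c) ^ DIM('a)) * emeasure lborel (f ` A))
      \<le> ennreal (c ^ DIM('a)) * emeasure lborel A"
    by (rule mult_left_mono) simp
  moreover have "ennreal (c ^ DIM('a)) * ennreal ((1 / c) ^ DIM('a)) = 1"
    using c by (simp add: ennreal_mult'[symmetric] power_mult_distrib[symmetric])
  ultimately show "emeasure lborel (f ` A) \<le> ennreal (c ^ DIM('a)) * emeasure lborel A"
    by (simp add: mult.assoc[symmetric])
qed (rule emeasure_similarity_image_ge[OF assms])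

lemma measure_similarity_image:
  fixes f :: "'a::euclidean_space \<Rightarrow> 'a"
  assumes c: "0 < c" and f: "\<And>x y. dist (f x) (f y) = c * dist x y" and A: "open A"
  shows "measure lborel (f ` A) = c ^ DIM('a) * measure lborel A"
  unfolding measure_def emeasure_similarity_image[OF assms] using c by (simp add: enn2real_mult)

text \<open>A ball is connected, so it cannot be spread over several of the disjoint open pieces.\<close>

lemma erosion_disjoint_Union:
  fixes P :: "'i \<Rightarrow> 'a::euclidean_space set"
  assumes "0 \<le> v" and op: "\<And>i. i \<in> I \<Longrightarrow> open (P i)" and disj: "disjoint_family_on P I"
  shows "erosion (\<Union>i\<in>I. P i) v = (\<Union>i\<in>I. erosion (P i) v)"
proof (intro equalityI subsetI)
  fix x assume "x \<in> erosion (\<Union>i\<in>I. P i) v"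
  then have sub: "cball x v \<subseteq> (\<Union>i\<in>I. P i)" by (simp add: erosion_def)
  moreover have x: "x \<in> cball x v" using \<open>0 \<le> v\<close> by simp
  ultimately obtain j where j: "j \<in> I" "x \<in> P j" by blast
  define Q where "Q = (\<Union>i\<in>I - {j}. P i)"
  have "open Q" using op by (auto simp: Q_def)
  have "P j \<inter> Q = {}" using disj j(1) by (fastforce simp: Q_def disjoint_family_on_def)
  moreover have cov: "cball x v \<subseteq> P j \<union> Q" using sub by (auto simp: Q_def)
  ultimately have "P j \<inter> cball x v = {} \<or> Q \<inter> cball x v = {}"
    using \<open>open Q\<close> op[OF j(1)] by (intro connectedD[of "cball x v"]) auto
  then have "cball x v \<subseteq> P j" using x j cov by blast
  then show "x \<in> (\<Union>i\<in>I. erosion (P i) v)" using j(1) by (auto simp: erosion_def)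
qed (auto simp: erosion_def)

lemma tube_volume_self_similar:
  fixes S :: "nat \<Rightarrow> 'a::euclidean_space \<Rightarrow> 'a"
  assumes T: "T = G \<union> (\<Union>i\<in>I. S i ` T)" and fin: "finite I" and "open G" "open T" "bounded T" "0 \<le> v"
    and S: "\<And>i x y. i \<in> I \<Longrightarrow> dist (S i x) (S i y) = r i * dist x y" and r: "\<And>i. i \<in> I \<Longrightarrow> 0 < r i"
    and GS: "\<And>i. i \<in> I \<Longrightarrow> G \<inter> S i ` T = {}"
    and SS: "\<And>i j. i \<in> I \<Longrightarrow> j \<in> I \<Longrightarrow> i \<noteq> j \<Longrightarrow> S i ` T \<inter> S j ` T = {}"
  shows "tube_volume T v = tube_volume G v + (\<Sum>i\<in>I. r i ^ DIM('a) * tube_volume T (v / r i))"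
proof -
  \<comment> \<open>The pieces of \<open>T\<close> form one disjoint family, with \<open>None\<close> as the index of \<open>G\<close>.\<close>
  define P where "P k = (case k of None \<Rightarrow> G | Some i \<Rightarrow> S i ` T)" for k
  define K where "K = insert None (Some ` I)"
  have "finite K" using fin by (simp add: K_def)
  have TP: "T = (\<Union>k\<in>K. P k)" using T by (simp add: K_def P_def)
  have op: "open (P k)" if "k \<in> K" for k
    using that \<open>open G\<close> similarity_image_open[OF r S \<open>open T\<close>] by (auto simp: P_def K_def)
  have bd: "bounded (P k)" if "k \<in> K" for k
    using \<open>bounded T\<close> by (rule bounded_subset) (use TP that in blast)
  have disj: "disjoint_family_on P K"
    using GS SS unfolding disjoint_family_on_def K_def P_def by (auto split: option.splits)
  have ero: "erosion T v = (\<Union>k\<in>K. erosion (P k) v)"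
    unfolding TP by (rule erosion_disjoint_Union[OF \<open>0 \<le> v\<close> op disj])
  have disj': "disjoint_family_on (\<lambda>k. erosion (P k) v) K"
    using disj erosion_subset[OF \<open>0 \<le> v\<close>] unfolding disjoint_family_on_def by blast
  have fin_emeasure: "X \<in> fmeasurable lborel" if "open X" "bounded X" for X :: "'a set"
    using that emeasure_bounded_finite[of X] by (auto simp: fmeasurable_def)
  have "measure lborel T = (\<Sum>k\<in>K. measure lborel (P k))"
    unfolding TP using fin_emeasure[OF op bd]
    by (intro measure_finite_Union \<open>finite K\<close> disj) (auto simp: fmeasurable_def top.not_eq_extremum)
  moreover have "measure lborel (erosion T v) = (\<Sum>k\<in>K. measure lborel (erosion (P k) v))"
    unfolding ero
    using fin_emeasure[OF open_erosion[OF op bd \<open>0 \<le> v\<close>] bounded_subset[OF bd erosion_subset[OF \<open>0 \<le> v\<close>]]]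
    by (intro measure_finite_Union \<open>finite K\<close> disj') (auto simp: fmeasurable_def top.not_eq_extremum)
  ultimately have "tube_volume T v = (\<Sum>k\<in>K. tube_volume (P k) v)"
    using op bd by (simp add: tube_volume_eq_diff_erosion \<open>open T\<close> \<open>bounded T\<close> \<open>0 \<le> v\<close> sum_subtractf)
  also have "\<dots> = tube_volume G v + (\<Sum>i\<in>I. tube_volume (S i ` T) v)"
    using fin by (simp add: K_def P_def sum.reindex)
  also have "(\<Sum>i\<in>I. tube_volume (S i ` T) v) = (\<Sum>i\<in>I. r i ^ DIM('a) * tube_volume T (v / r i))"
  proof (rule sum.cong[OF refl])
    fix i assume i: "i \<in> I"
    have "open (S i ` T)" "bounded (S i ` T)"
      using op[of "Some i"] bd[of "Some i"] i by (auto simp: K_def P_def)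
    moreover have "0 \<le> v / r i" using \<open>0 \<le> v\<close> r[OF i] by simp
    ultimately show "tube_volume (S i ` T) v = r i ^ DIM('a) * tube_volume T (v / r i)"
      using open_erosion[OF \<open>open T\<close> \<open>bounded T\<close> \<open>0 \<le> v / r i\<close>]
      by (simp add: tube_volume_eq_diff_erosion \<open>open T\<close> \<open>bounded T\<close> \<open>0 \<le> v\<close>
          similarity_image_erosion[OF r[OF i] S[OF i]] measure_similarity_image[OF r[OF i] S[OF i]] right_diff_distrib)
  qed
  finally show ?thesis .
qed

section \<open>The scaling equation of the tube volume of a tiling\<close>

text \<open>Split off the first letter of a word.\<close>

lemma Union_tiling:
  fixes S :: "nat \<Rightarrow> 'a::euclidean_space \<Rightarrow> 'a"
  shows "\<Union>(tiling N S U) = generator N S U \<union> (\<Union>i\<in>{1..N}. S i ` \<Union>(tiling N S U))"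
proof (intro equalityI subsetI)
  fix x assume "x \<in> \<Union>(tiling N S U)"
  then obtain w where w: "w \<in> lists {1..N}" "x \<in> word_map S w ` generator N S U"
    by (auto simp: tiling_def)
  show "x \<in> generator N S U \<union> (\<Union>i\<in>{1..N}. S i ` \<Union>(tiling N S U))"
  proof (cases w)
    case Nil
    then show ?thesis using w by simp
  next
    case (Cons i u)
    then have "i \<in> {1..N}" "x \<in> S i ` word_map S u ` generator N S U"
      using w by (auto simp: image_comp)
    moreover have "word_map S u ` generator N S U \<in> tiling N S U"
      using w Cons by (auto simp: tiling_def)
    ultimately show ?thesis by blast
  qed
next
  fix x assume "x \<in> generator N S U \<union> (\<Union>i\<in>{1..N}. S i ` \<Union>(tiling N S U))"
  then consider "x \<in> generator N S U" | i A where "i \<in> {1..N}" "A \<in> tiling N S U" "x \<in> S i ` A"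
    by blast
  then show "x \<in> \<Union>(tiling N S U)"
  proof cases
    case 1
    then have "generator N S U \<in> tiling N S U"
      unfolding tiling_def by (auto intro!: exI[of _ "[]"])
    then show ?thesis using 1 by blast
  next
    case 2
    then obtain w where w: "w \<in> lists {1..N}" "A = word_map S w ` generator N S U"
      by (auto simp: tiling_def)
    have "S i ` A \<in> tiling N S U"
      unfolding tiling_def using w 2(1) by (auto intro!: exI[of _ "i # w"] simp: image_comp)
    then show ?thesis using 2 by blast
  qed
qed

lemma Union_tiling_subset:
  assumes "\<And>i. i \<in> {1..N} \<Longrightarrow> S i ` U \<subseteq> U"
  shows "\<Union>(tiling N S U) \<subseteq> U"
proof -
  have "word_map S w ` U \<subseteq> U" if "w \<in> lists {1..N}" for w
    using that
  proof (induction w)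
    case (Cons i w)
    then show ?case using assms[of i] by (force simp: image_comp[symmetric])
  qed simp
  then show ?thesis unfolding tiling_def generator_def by blast
qed

lemma open_generator:
  fixes S :: "nat \<Rightarrow> 'a::euclidean_space \<Rightarrow> 'a"
  assumes "ifs N S r" "open U" "bounded U"
  shows "open (generator N S U)"
proof -
  have "compact (S i ` closure U)" if "i \<in> {1..N}" for i
  proof (rule compact_continuous_image)
    have "0 < r i" "\<And>x y. dist (S i x) (S i y) = r i * dist x y"
      using assms(1) that by (auto simp: ifs_def contracting_similarity_def)
    then have "(r i)-lipschitz_on UNIV (S i)"
      by (intro lipschitz_onI) auto
    then show "continuous_on (closure U) (S i)"
      using lipschitz_on_continuous_on continuous_on_subset by blast
  qed (simp add: assms(3))
  then have "closed (set_map N S (closure U))"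
    unfolding set_map_def by (intro closed_UN) (auto intro: compact_imp_closed)
  then show ?thesis unfolding generator_def by (intro open_Diff \<open>open U\<close>)
qed

lemma open_Union_tiling:
  fixes S :: "nat \<Rightarrow> 'a::euclidean_space \<Rightarrow> 'a"
  assumes "ifs N S r" "open U" "bounded U"
  shows "open (\<Union>(tiling N S U))"
proof -
  have "open (word_map S w ` generator N S U)" if "w \<in> lists {1..N}" for w
    using that
  proof (induction w)
    case Nil
    then show ?case using open_generator[OF assms] by simp
  next
    case (Cons i w)
    have "0 < r i" "\<And>x y. dist (S i x) (S i y) = r i * dist x y"
      using Cons.hyps assms(1) by (auto simp: ifs_def contracting_similarity_def)
    from similarity_image_open[OF this Cons.IH] show ?case by (simp add: image_comp)
  qed
  then show ?thesis unfolding tiling_def by (intro open_Union) blast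
qed

theorem tube_volume_tiling:
  fixes S :: "nat \<Rightarrow> 'a::euclidean_space \<Rightarrow> 'a"
  assumes ifs: "ifs N S r" and feas: "feasible_open_set N S U" and "0 \<le> v"
  shows "tube_volume (\<Union>(tiling N S U)) v =
    tube_volume (generator N S U) v + (\<Sum>i=1..N. r i ^ DIM('a) * tube_volume (\<Union>(tiling N S U)) (v / r i))"
proof -
  have U: "open U" "bounded U" and SU: "\<And>i. i \<in> {1..N} \<Longrightarrow> S i ` U \<subseteq> U"
    and SS: "\<And>i j. i \<in> {1..N} \<Longrightarrow> j \<in> {1..N} \<Longrightarrow> i \<noteq> j \<Longrightarrow> S i ` U \<inter> S j ` U = {}"
    using feas by (auto simp: feasible_open_set_def)
  have sub: "\<Union>(tiling N S U) \<subseteq> U" by (rule Union_tiling_subset[OF SU])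
  show ?thesis
  proof (rule tube_volume_self_similar[OF Union_tiling])
    show "bounded (\<Union>(tiling N S U))" using U(2) sub by (rule bounded_subset)
    show "generator N S U \<inter> S i ` \<Union>(tiling N S U) = {}" if "i \<in> {1..N}" for i
      using that sub closure_subset[of U] unfolding generator_def set_map_def by blast
    show "S i ` \<Union>(tiling N S U) \<inter> S j ` \<Union>(tiling N S U) = {}"
      if "i \<in> {1..N}" "j \<in> {1..N}" "i \<noteq> j" for i j
      using SS[OF that] sub by blast
  qed (use ifs U open_generator[OF ifs U] open_Union_tiling[OF ifs U] \<open>0 \<le> v\<close>
      in \<open>auto simp: ifs_def contracting_similarity_def\<close>)
qed


section \<open>Tails of the volume integral in logarithmic scale\<close>

lemma set_integrable_lborel_if_has_integral:
  fixes f :: "real \<Rightarrow> real"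
  assumes "(f has_integral I) S" and "\<And>x. x \<in> S \<Longrightarrow> 0 \<le> f x"
    and [measurable]: "f \<in> borel_measurable borel" "S \<in> sets borel"
  shows "set_integrable lborel S f"
proof -
  have "f absolutely_integrable_on S"
    using assms(1,2) by (intro nonnegative_absolutely_integrable_1) (auto simp: integrable_on_def)
  then show ?thesis
    unfolding set_integrable_def by (subst (asm) integrable_completion) auto
qed

text \<open>With \<open>q = D - d\<close>, the substitution \<open>v = exp (- x)\<close> turns this into the integral over \<open>{..t}\<close> of
  \<open>log_scaled V q x\<close> as defined below. The integral over \<open>v\<close> is the form in which
  dilations are easy to carry out; these become the shifts of the renewal equation.\<close>

definition log_tail :: "(real \<Rightarrow> real) \<Rightarrow> real \<Rightarrow> real \<Rightarrow> real" where
  "log_tail V q t = (LINT v:{exp (- t)..}|lborel. v powr (q - 1) * V v)"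

locale bounded_mono =
  fixes V :: "real \<Rightarrow> real" and B :: real
  assumes mono: "mono V" and nonneg: "\<And>v. 0 \<le> V v" and bounded: "\<And>v. V v \<le> B"
begin

lemma measurable_V [measurable]: "V \<in> borel_measurable borel"
  using mono by (rule borel_measurable_mono)

lemma set_integrable_powr_mult_above:
  assumes "q < 0" "0 < u"
  shows "set_integrable lborel {u..} (\<lambda>v. v powr (q - 1) * V v)"
proof (rule set_integrable_bound)
  show "set_integrable lborel {u..} (\<lambda>v. v powr (q - 1) * B)"
    using has_integral_powr_to_inf[of "q - 1" u] assms
    by (intro set_integrable_mult_left set_integrable_lborel_if_has_integral) auto
  show "AE v in lborel. v \<in> {u..} \<longrightarrow> norm (v powr (q - 1) * V v) \<le> norm (v powr (q - 1) * B)"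
    using nonneg bounded by (auto simp: abs_mult intro!: mult_left_mono order_trans[OF bounded abs_ge_self])
qed (auto simp: set_borel_measurable_def)

text \<open>Boundedness of \<open>V\<close> and \<open>q < 0\<close> give convergence at infinity; near \<open>0\<close> the integrand is at most
  \<open>v powr (e - 1)\<close>.\<close>

lemma set_integrable_powr_mult:
  assumes "q < 0" "0 < e" "0 < u" and bound: "\<And>v. 0 < v \<Longrightarrow> v < u \<Longrightarrow> V v \<le> v powr (e - q)"
  shows "set_integrable lborel {0<..} (\<lambda>v. v powr (q - 1) * V v)"
proof -
  have "set_integrable lborel {0<..<u} (\<lambda>v. v powr (q - 1) * V v)"
  proof (rule set_integrable_bound)
    have "set_integrable lborel {0..u} (\<lambda>v. v powr (e - 1))"
      using has_integral_powr_from_0[of "e - 1" u] assms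
      by (intro set_integrable_lborel_if_has_integral) auto
    then show "set_integrable lborel {0<..<u} (\<lambda>v. v powr (e - 1))"
      by (rule set_integrable_subset) auto
    have "v powr (q - 1) * V v \<le> v powr (e - 1)" if "0 < v" "v < u" for v
      using mult_left_mono[OF bound[OF that], of "v powr (q - 1)"] that
      by (simp flip: powr_add)
    then show "AE v in lborel. v \<in> {0<..<u} \<longrightarrow> norm (v powr (q - 1) * V v) \<le> norm (v powr (e - 1))"
      using nonneg by (auto simp: abs_mult)
  qed (auto simp: set_borel_measurable_def)
  then have "set_integrable lborel ({0<..<u} \<union> {u..}) (\<lambda>v. v powr (q - 1) * V v)"
    by (rule set_integrable_Un) (use set_integrable_powr_mult_above assms in auto)
  moreover have "{0<..<u} \<union> {u..} = {0<..}" using \<open>0 < u\<close> by auto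
  ultimately show ?thesis by simp
qed

lemma log_tail_tendsto:
  assumes int: "set_integrable lborel {0<..} (\<lambda>v. v powr (q - 1) * V v)"
  shows "(log_tail V q \<longlongrightarrow> (LINT v:{0<..}|lborel. v powr (q - 1) * V v)) at_top"
  unfolding log_tail_def[abs_def] set_lebesgue_integral_def
proof (rule integral_dominated_convergence_at_top)
  show "integrable lborel (\<lambda>v. indicator {0<..} v *\<^sub>R (v powr (q - 1) * V v))"
    using int by (simp add: set_integrable_def)
  show "AE v in lborel. ((\<lambda>t. indicator {exp (- t)..} v *\<^sub>R (v powr (q - 1) * V v))
      \<longlongrightarrow> indicator {0<..} v *\<^sub>R (v powr (q - 1) * V v)) at_top"
  proof (rule AE_I2)
    fix v :: real
    show "((\<lambda>t. indicator {exp (- t)..} v *\<^sub>R (v powr (q - 1) * V v))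
      \<longlongrightarrow> indicator {0<..} v *\<^sub>R (v powr (q - 1) * V v)) at_top"
    proof (cases "0 < v")
      case True
      have "eventually (\<lambda>t. v \<in> {exp (- t)..}) at_top"
        using eventually_ge_at_top[of "- ln v"]
      proof eventually_elim
        case (elim t)
        then have "exp (- t) \<le> exp (ln v)" by simp
        then show ?case using True by simp
      qed
      then have "eventually (\<lambda>t. indicator {exp (- t)..} v *\<^sub>R (v powr (q - 1) * V v) =
          indicator {0<..} v *\<^sub>R (v powr (q - 1) * V v)) at_top"
        by (rule eventually_mono) (use True in \<open>simp add: indicator_def\<close>)
      then show ?thesis by (rule tendsto_eventually)
    next
      case False
      then have "\<not> exp (- t) \<le> v" for t using exp_gt_zero[of "- t"] by linarith
      then show ?thesis using False by simp
    qed
  qed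
  show "eventually (\<lambda>t. AE v in lborel. norm (indicator {exp (- t)..} v *\<^sub>R (v powr (q - 1) * V v))
      \<le> indicator {0<..} v *\<^sub>R (v powr (q - 1) * V v)) at_top"
  proof (intro always_eventually allI AE_I2)
    fix t v :: real
    have "v \<in> {exp (- t)..} \<Longrightarrow> 0 < v" using less_le_trans[OF exp_gt_zero[of "- t"]] by simp
    then show "norm (indicator {exp (- t)..} v *\<^sub>R (v powr (q - 1) * V v))
      \<le> indicator {0<..} v *\<^sub>R (v powr (q - 1) * V v)"
      using nonneg by (auto simp: indicator_def abs_mult)
  qed
qed auto

lemma log_tail_diff:
  assumes "q < 0" "s \<le> t"
  shows "log_tail V q t - log_tail V q s = (LINT v:{exp (- t)..<exp (- s)}|lborel. v powr (q - 1) * V v)"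
proof -
  have le: "exp (- t) \<le> exp (- s)" using \<open>s \<le> t\<close> by simp
  have "{a..} = {a..<b} \<union> {b..}" if "a \<le> b" for a b :: real
    using that by auto
  from this[OF le] have "{exp (- t)..} = {exp (- t)..<exp (- s)} \<union> {exp (- s)..}" .
  then have "log_tail V q t = (LINT v:{exp (- t)..<exp (- s)} \<union> {exp (- s)..}|lborel. v powr (q - 1) * V v)"
    by (simp add: log_tail_def)
  also have "\<dots> = (LINT v:{exp (- t)..<exp (- s)}|lborel. v powr (q - 1) * V v) + log_tail V q s"
    unfolding log_tail_def
    by (intro set_integral_Un set_integrable_subset[OF set_integrable_powr_mult_above[OF \<open>q < 0\<close>, of "exp (- t)"]])
      (use \<open>s \<le> t\<close> order_trans[OF le] in auto)
  finally show ?thesis by simp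
qed

lemma log_tail_dilation:
  assumes "0 < c"
  shows "(LINT v:{exp (- t)..}|lborel. v powr (q - 1) * V (v / c)) = c powr q * log_tail V q (t + ln c)"
proof -
  have "(LINT v:{exp (- t)..}|lborel. v powr (q - 1) * V (v / c)) =
      c * (\<integral>v. indicator {exp (- t)..} (0 + c * v) *\<^sub>R ((0 + c * v) powr (q - 1) * V ((0 + c * v) / c)) \<partial>lborel)"
    unfolding set_lebesgue_integral_def using \<open>0 < c\<close>
    by (subst lborel_integral_real_affine[of c _ 0]) auto
  also have "\<dots> = c * (\<integral>v. c powr (q - 1) * (indicator {exp (- (t + ln c))..} v *\<^sub>R (v powr (q - 1) * V v)) \<partial>lborel)"
  proof (intro arg_cong[where f="\<lambda>x. c * x"] Bochner_Integration.integral_cong refl)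
    fix v :: real
    have "exp (- t) \<le> c * v \<longleftrightarrow> exp (- (t + ln c)) \<le> v"
      using \<open>0 < c\<close> by (simp add: exp_diff field_simps exp_add exp_minus)
    moreover have "0 < v" if "exp (- (t + ln c)) \<le> v"
      using that exp_gt_zero[of "- (t + ln c)"] by linarith
    ultimately show "indicator {exp (- t)..} (0 + c * v) *\<^sub>R ((0 + c * v) powr (q - 1) * V ((0 + c * v) / c)) =
        c powr (q - 1) * (indicator {exp (- (t + ln c))..} v *\<^sub>R (v powr (q - 1) * V v))"
      using \<open>0 < c\<close> by (auto simp: indicator_def powr_mult)
  qed
  also have "\<dots> = c powr q * log_tail V q (t + ln c)"
    unfolding log_tail_def set_lebesgue_integral_def integral_mult_right_zero
    using \<open>0 < c\<close> by (simp add: powr_diff)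
  finally show ?thesis .
qed

end

lemma set_integral_inverse:
  fixes s t K :: real
  assumes "s \<le> t"
  shows "set_integrable lborel {exp (- t)..<exp (- s)} (\<lambda>v. K / v)"
    and "(LINT v:{exp (- t)..<exp (- s)}|lborel. K / v) = K * (t - s)"
proof -
  have FTC: "has_bochner_integral lborel (\<lambda>v. K / v * indicator {exp (- t)..exp (- s)} v)
      (K * ln (exp (- s)) - K * ln (exp (- t)))"
  proof (rule has_bochner_integral_FTC_Icc_real)
    fix v assume "exp (- t) \<le> v"
    then have "0 < v" using exp_gt_zero[of "- t"] by linarith
    then show "((\<lambda>v. K * ln v) has_real_derivative K / v) (at v)"
      and "isCont (\<lambda>v. K / v) v"
      by (auto intro!: derivative_eq_intros continuous_intros)
  qed (use assms in auto)
  have ae: "AE v in lborel. indicator {exp (- t)..<exp (- s)} v *\<^sub>R (K / v) = K / v * indicator {exp (- t)..exp (- s)} v"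
    using AE_lborel_singleton[of "exp (- s)"] by eventually_elim (auto simp: indicator_def)
  from FTC have "has_bochner_integral lborel (\<lambda>v. indicator {exp (- t)..<exp (- s)} v *\<^sub>R (K / v)) (K * (t - s))"
    by (subst has_bochner_integral_cong_AE[OF _ _ ae]) (auto simp: algebra_simps)
  then show "set_integrable lborel {exp (- t)..<exp (- s)} (\<lambda>v. K / v)"
    and "(LINT v:{exp (- t)..<exp (- s)}|lborel. K / v) = K * (t - s)"
    unfolding set_integrable_def set_lebesgue_integral_def by (auto simp: has_bochner_integral_iff)
qed

text \<open>The function \<open>\<epsilon> powr q * V \<epsilon>\<close> at \<open>\<epsilon> = exp (- t)\<close>; for \<open>q = D - d\<close> its limit at infinity is
  the content.\<close>

definition log_scaled :: "(real \<Rightarrow> real) \<Rightarrow> real \<Rightarrow> real \<Rightarrow> real" where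
  "log_scaled V q t = exp (- q * t) * V (exp (- t))"

context bounded_mono
begin

lemma powr_mult_eq_log_scaled:
  assumes "0 < v"
  shows "v powr (q - 1) * V v = log_scaled V q (- ln v) / v"
  using assms by (simp add: log_scaled_def powr_def exp_diff left_diff_distrib)

lemma log_tail_diff_ge:
  assumes "q < 0" "s \<le> t" and K: "\<And>x. x \<in> {s..t} \<Longrightarrow> K \<le> log_scaled V q x"
  shows "K * (t - s) \<le> log_tail V q t - log_tail V q s"
  unfolding log_tail_diff[OF assms(1,2)] set_integral_inverse(2)[OF \<open>s \<le> t\<close>, symmetric]
proof (rule set_integral_mono[OF set_integral_inverse(1)[OF \<open>s \<le> t\<close>]])
  show "set_integrable lborel {exp (- t)..<exp (- s)} (\<lambda>v. v powr (q - 1) * V v)"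
    by (rule set_integrable_subset[OF set_integrable_powr_mult_above[OF \<open>q < 0\<close>, of "exp (- t)"]]) auto
  fix v assume v: "v \<in> {exp (- t)..<exp (- s)}"
  then have "0 < v" using less_le_trans[OF exp_gt_zero[of "- t"]] by simp
  with v have "- t \<le> ln v" "ln v \<le> - s" by (auto simp: ln_ge_iff ln_less_cancel_iff[of v "exp (- s)", simplified] intro: less_imp_le)
  then show "K / v \<le> v powr (q - 1) * V v"
    using K[of "- ln v"] \<open>0 < v\<close> by (simp add: powr_mult_eq_log_scaled divide_right_mono)
qed

lemma log_tail_diff_le:
  assumes "q < 0" "s \<le> t" and K: "\<And>x. x \<in> {s..t} \<Longrightarrow> log_scaled V q x \<le> K"
  shows "log_tail V q t - log_tail V q s \<le> K * (t - s)"
  unfolding log_tail_diff[OF assms(1,2)] set_integral_inverse(2)[OF \<open>s \<le> t\<close>, symmetric]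
proof (rule set_integral_mono[OF _ set_integral_inverse(1)[OF \<open>s \<le> t\<close>]])
  show "set_integrable lborel {exp (- t)..<exp (- s)} (\<lambda>v. v powr (q - 1) * V v)"
    by (rule set_integrable_subset[OF set_integrable_powr_mult_above[OF \<open>q < 0\<close>, of "exp (- t)"]]) auto
  fix v assume v: "v \<in> {exp (- t)..<exp (- s)}"
  then have "0 < v" using less_le_trans[OF exp_gt_zero[of "- t"]] by simp
  with v have "- t \<le> ln v" "ln v \<le> - s" by (auto simp: ln_ge_iff ln_less_cancel_iff[of v "exp (- s)", simplified] intro: less_imp_le)
  then show "v powr (q - 1) * V v \<le> K / v"
    using K[of "- ln v"] \<open>0 < v\<close> by (simp add: powr_mult_eq_log_scaled divide_right_mono)
qed

end


section \<open>Volume functions satisfying a scaling equation\<close>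

text \<open>The parameter \<open>q\<close> stands for \<open>D - d\<close>, so \<open>r i powr (D - q)\<close> is the volume ratio of the \<open>i\<close>-th
  similarity; \<open>e\<close> is the margin by which the dimension of the frontier of the generator stays below
  \<open>D\<close>.\<close>

locale self_similar_volume =
  renewal_weights J "\<lambda>i. r i powr D" "\<lambda>i. - ln (r i)" + V: bounded_mono V B + W: bounded_mono W B'
  for J :: "'i set" and r :: "'i \<Rightarrow> real" and D :: real
    and V :: "real \<Rightarrow> real" and B :: real and W :: "real \<Rightarrow> real" and B' :: real +
  fixes q e u :: real
  assumes r_pos: "\<And>i. i \<in> J \<Longrightarrow> 0 < r i"
    and q_neg: "q < 0"
    and self_similar: "\<And>v. 0 < v \<Longrightarrow> V v = W v + (\<Sum>i\<in>J. r i powr (D - q) * V (v / r i))"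
    and e_pos: "0 < e" and u_pos: "0 < u"
    and W_small: "\<And>v. 0 < v \<Longrightarrow> v < u \<Longrightarrow> W v \<le> v powr (e - q)"
begin

lemma set_integrable_generator: "set_integrable lborel {0<..} (\<lambda>v. v powr (q - 1) * W v)"
  by (rule W.set_integrable_powr_mult[OF q_neg e_pos u_pos W_small])

text \<open>The scaling equation integrated over \<open>{exp (- t)..}\<close>. Dilating the \<open>i\<close>-th summand turns the volume
  ratio into the weight \<open>r i powr D\<close> and shifts \<open>t\<close> by the step \<open>- ln (r i)\<close>.\<close>

lemma defect_log_tail: "defect (log_tail V q) t = log_tail W q t"
proof -
  have int: "set_integrable lborel {exp (- t)..} (\<lambda>v. v powr (q - 1) * V (v / r i))" if "i \<in> J" for i
  proof -
    interpret Vi: bounded_mono "\<lambda>v. V (v / r i)" B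
      using V.nonneg V.bounded r_pos[OF that] by unfold_locales (auto intro!: monoI monoD[OF V.mono] divide_right_mono)
    show ?thesis by (rule Vi.set_integrable_powr_mult_above[OF q_neg exp_gt_zero])
  qed
  have int_sum: "set_integrable lborel {exp (- t)..} (\<lambda>v. \<Sum>i\<in>J. r i powr (D - q) * (v powr (q - 1) * V (v / r i)))"
    using int unfolding set_integrable_def real_scaleR_def sum_distrib_left
    by (auto simp: mult.left_commute[of "indicator _ _"])
  have "log_tail V q t = (LINT v:{exp (- t)..}|lborel. v powr (q - 1) * W v
      + (\<Sum>i\<in>J. r i powr (D - q) * (v powr (q - 1) * V (v / r i))))"
    unfolding log_tail_def
  proof (intro set_lebesgue_integral_cong allI impI)
    fix v assume "v \<in> {exp (- t)..}"
    then have "0 < v" using less_le_trans[OF exp_gt_zero[of "- t"]] by simp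
    then show "v powr (q - 1) * V v = v powr (q - 1) * W v
      + (\<Sum>i\<in>J. r i powr (D - q) * (v powr (q - 1) * V (v / r i)))"
      by (simp add: self_similar distrib_left sum_distrib_left mult_ac)
  qed auto
  also have "\<dots> = log_tail W q t
      + (LINT v:{exp (- t)..}|lborel. \<Sum>i\<in>J. r i powr (D - q) * (v powr (q - 1) * V (v / r i)))"
    unfolding log_tail_def by (intro set_integral_add W.set_integrable_powr_mult_above q_neg int_sum exp_gt_zero)
  also have "(LINT v:{exp (- t)..}|lborel. \<Sum>i\<in>J. r i powr (D - q) * (v powr (q - 1) * V (v / r i)))
      = (\<Sum>i\<in>J. LINT v:{exp (- t)..}|lborel. r i powr (D - q) * (v powr (q - 1) * V (v / r i)))"
    using int unfolding set_lebesgue_integral_def set_integrable_def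
    by (simp add: sum_distrib_left mult.left_commute[of "indicator _ _"])
  also have "\<dots> = (\<Sum>i\<in>J. r i powr D * log_tail V q (t - - ln (r i)))"
  proof (rule sum.cong[OF refl])
    fix i assume "i \<in> J"
    have "r i powr D = r i powr (D - q) * r i powr q" by (simp flip: powr_add)
    then show "(LINT v:{exp (- t)..}|lborel. r i powr (D - q) * (v powr (q - 1) * V (v / r i)))
      = r i powr D * log_tail V q (t - - ln (r i))"
      using V.log_tail_dilation[OF r_pos[OF \<open>i \<in> J\<close>]] by simp
  qed
  finally show ?thesis by (simp add: defect_def)
qed

lemma defect_log_scaled: "defect (log_scaled V q) t = log_scaled W q t"
proof -
  have "r i powr D * log_scaled V q (t - - ln (r i)) = exp (- q * t) * (r i powr (D - q) * V (exp (- t) / r i))"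
    if "i \<in> J" for i
  proof -
    have "exp (- (t - - ln (r i))) = exp (- t) / r i"
      using r_pos[OF that] by (simp add: exp_diff exp_minus)
    moreover have "r i powr D * exp (- q * (t - - ln (r i))) = exp (- q * t) * r i powr (D - q)"
      using r_pos[OF that] by (simp add: powr_def exp_add[symmetric] algebra_simps)
    ultimately show ?thesis unfolding log_scaled_def by (simp add: mult.assoc[symmetric])
  qed
  then show ?thesis
    unfolding defect_def
    by (simp add: log_scaled_def self_similar[of "exp (- t)"] distrib_left sum_distrib_left)
qed

abbreviation limit_value :: real where
  "limit_value \<equiv> (LINT v:{0<..}|lborel. v powr (q - 1) * W v) / mean_step"

lemma defect_log_tail_tendsto:
  "(defect (log_tail V q) \<longlongrightarrow> (LINT v:{0<..}|lborel. v powr (q - 1) * W v)) at_top"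
  using W.log_tail_tendsto[OF set_integrable_generator] by (simp add: defect_log_tail[abs_def])

theorem average_volume_limit: "((\<lambda>t. (log_tail V q t - log_tail V q 0) / t) \<longlongrightarrow> limit_value) at_top"
proof -
  have mono: "log_tail V q s \<le> log_tail V q t" if "s \<le> t" for s t
    using V.log_tail_diff_ge[OF q_neg that, of 0] V.nonneg by (simp add: log_scaled_def)
  have "bounded (log_tail V q ` {s..t})" for s t
    by (rule bounded_subset[OF bounded_closed_interval[of "log_tail V q s" "log_tail V q t"]]) (auto intro: mono)
  from mean_renewal[OF defect_log_tail_tendsto this]
  have "((\<lambda>t. log_tail V q t / t - log_tail V q 0 / t) \<longlongrightarrow> limit_value - 0) at_top"
    by (intro tendsto_diff tendsto_divide_0[OF tendsto_const] filterlim_at_top_imp_at_infinity filterlim_ident)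
  then show ?thesis by (simp add: diff_divide_distrib)
qed

theorem volume_limit_nonlattice:
  assumes "\<not> discrete (group_closure ((\<lambda>i. ln (r i)) ` J))"
  shows "(log_scaled V q \<longlongrightarrow> limit_value) at_top"
proof (rule key_renewal)
  show "0 \<le> log_scaled V q t" for t using V.nonneg by (simp add: log_scaled_def)
  show "0 \<le> - q" using q_neg by simp
  show "log_scaled V q t \<le> exp (- q * (t - s)) * log_scaled V q s" if "s \<le> t" for s t
  proof -
    have "log_scaled V q t \<le> exp (- q * t) * V (exp (- s))"
      unfolding log_scaled_def using that by (intro mult_left_mono monoD[OF V.mono]) auto
    also have "\<dots> = exp (- q * (t - s)) * log_scaled V q s"
      unfolding log_scaled_def mult.assoc[symmetric] exp_add[symmetric] by (simp add: algebra_simps)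
    finally show ?thesis .
  qed
  show "(defect (log_scaled V q) \<longlongrightarrow> 0) at_top"
  proof (rule tendsto_sandwich[where f = "\<lambda>_. 0" and h = "\<lambda>t. exp (- e * t)"])
    show "eventually (\<lambda>t. 0 \<le> defect (log_scaled V q) t) at_top"
      using W.nonneg by (simp add: defect_log_scaled log_scaled_def)
    show "eventually (\<lambda>t. defect (log_scaled V q) t \<le> exp (- e * t)) at_top"
      using eventually_gt_at_top[of "- ln u"]
    proof eventually_elim
      case (elim t)
      then have "exp (- t) < exp (ln u)" by simp
      then have "W (exp (- t)) \<le> exp (- t) powr (e - q)" using u_pos by (intro W_small) auto
      then have "log_scaled W q t \<le> exp (- q * t) * exp (- t) powr (e - q)"
        unfolding log_scaled_def by (rule mult_left_mono) simp
      also have "\<dots> = exp (- e * t)"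
        by (simp add: powr_def exp_add[symmetric] algebra_simps)
      finally show ?case by (simp add: defect_log_scaled)
    qed
    show "((\<lambda>t. exp (- e * t)) \<longlongrightarrow> 0) at_top"
      using e_pos by real_asymp
  qed simp
  show "\<exists>a\<in>step_sums. \<exists>b\<in>step_sums. 0 < a - b \<and> a - b < \<delta>" if "\<delta> > 0" for \<delta>
    using step_sums_differences_dense[OF _ that] assms by simp
qed (use V.log_tail_diff_ge[OF q_neg] V.log_tail_diff_le[OF q_neg] defect_log_tail_tendsto in auto)

end

section \<open>The contents of a self-similar tiling\<close>

lemma parallel_frontier_Int:
  fixes A :: "'a::euclidean_space set"
  assumes "bounded A"
  shows "parallel_set (frontier A) v \<inter> A = {x \<in> A. infdist x (frontier A) \<le> v}"
proof (cases "A = {}")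
  case False
  then have "frontier A \<noteq> {}" using assms by (metis frontier_eq_empty not_bounded_UNIV)
  then show ?thesis by (auto simp: parallel_set_def)
qed simp

lemma measure_parallel_frontier:
  fixes A :: "'a::euclidean_space set"
  assumes "bounded A"
  shows "measure lebesgue (parallel_set (frontier A) v \<inter> A) = tube_volume A v"
  by (simp add: parallel_frontier_Int[OF assms] tube_volume_def)

text \<open>Vanishing content of an exponent \<open>s < D\<close> bounds the tube volume near \<open>0\<close> by \<open>v powr (d - s)\<close>, so
  \<open>e = D - s\<close> works. The infimum of an empty set of reals would be an unspecified number, so it has to be seen first that
  some exponent has content zero: \<open>d + 1\<close> does, by the trivial bound on the volume.\<close>

lemma tube_volume_small_if_minkowski_dim_less:
  fixes A :: "'a::euclidean_space set"
  assumes A: "open A" "bounded A" and dim: "minkowski_dim (frontier A) A < D"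
  obtains e u where "0 < e" "0 < u" "\<And>v. 0 < v \<Longrightarrow> v < u \<Longrightarrow> tube_volume A v \<le> v powr (e - (D - DIM('a)))"
proof -
  define X where "X = {s. 0 \<le> s \<and> has_minkowski_content s (frontier A) A 0}"
  have "((\<lambda>v. v powr (real DIM('a) + 1 - DIM('a)) * tube_volume A v) \<longlongrightarrow> 0) (at_right 0)"
  proof (rule tendsto_sandwich[where f = "\<lambda>_. 0" and h = "\<lambda>v. v * measure lborel A"])
    show "((\<lambda>v. v * measure lborel A) \<longlongrightarrow> 0) (at_right 0)"
      by (auto intro!: tendsto_eq_intros)
    show "eventually (\<lambda>v. v powr (real DIM('a) + 1 - DIM('a)) * tube_volume A v \<le> v * measure lborel A) (at_right 0)"
      using eventually_at_right_less[of "0::real"]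
      by eventually_elim (auto intro!: mult_left_mono tube_volume_le A)
  qed (auto simp: tube_volume_nonneg)
  then have "real DIM('a) + 1 \<in> X"
    by (simp add: X_def has_minkowski_content_def measure_parallel_frontier[OF A(2)])
  moreover have "Inf X < D" using dim by (simp add: minkowski_dim_def X_def)
  ultimately obtain s where s: "s \<in> X" "s < D" using cInf_lessD[of X D] by blast
  have "eventually (\<lambda>v. v powr (s - DIM('a)) * tube_volume A v < 1) (at_right 0)"
    using s(1) by (intro order_tendstoD(2)[of _ 0])
      (auto simp: X_def has_minkowski_content_def measure_parallel_frontier[OF A(2)])
  then obtain u where u: "u > 0" "\<And>v. 0 < v \<Longrightarrow> v < u \<Longrightarrow> v powr (s - DIM('a)) * tube_volume A v < 1"
    by (auto simp: eventually_at_right_field)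
  have "tube_volume A v \<le> v powr ((D - s) - (D - DIM('a)))" if "0 < v" "v < u" for v
  proof -
    have "v powr (DIM('a) - s) * (v powr (s - DIM('a)) * tube_volume A v) \<le> v powr (DIM('a) - s) * 1"
      using u(2)[OF that] by (intro mult_left_mono) auto
    then show ?thesis using \<open>0 < v\<close> by (simp add: mult.assoc[symmetric] flip: powr_add)
  qed
  then show ?thesis using that[of "D - s" u] u(1) s(2) by simp
qed

lemma sum_powr_similarity_dimension:
  assumes "ifs N S r"
  shows "(\<Sum>i=1..N. r i powr similarity_dimension N r) = 1"
  unfolding similarity_dimension_def
  by (rule theI'[OF ex1_similarity_dimension]) (use assms in \<open>auto simp: ifs_def contracting_similarity_def\<close>)

text \<open>The average content integrates over closed intervals, while \<open>log_tail_diff\<close> produces half-open ones;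
  they differ by a null set.\<close>

lemma average_window_eq:
  assumes "bounded_mono V B" "q < 0" "0 < \<delta>" "\<delta> < 1"
  shows "(LINT v:{\<delta>..1}|lborel. v powr q * V v / v) = log_tail V q (- ln \<delta>) - log_tail V q 0"
proof -
  interpret bounded_mono V B by fact
  have "(LINT v:{\<delta>..1}|lborel. v powr q * V v / v) = (LINT v:{\<delta>..<1}|lborel. v powr (q - 1) * V v)"
    unfolding set_lebesgue_integral_def
  proof (rule integral_cong_AE)
    show "AE v in lborel. indicator {\<delta>..1} v *\<^sub>R (v powr q * V v / v) = indicator {\<delta>..<1} v *\<^sub>R (v powr (q - 1) * V v)"
      using AE_lborel_singleton[of 1]
      by eventually_elim (use \<open>0 < \<delta>\<close> in \<open>auto simp: indicator_def powr_diff\<close>)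
  qed auto
  then show ?thesis using log_tail_diff[of q 0 "- ln \<delta>"] assms by simp
qed

theorem corollary3p5:
  fixes S :: "nat \<Rightarrow> 'a::euclidean_space \<Rightarrow> 'a"
    and r :: "nat \<Rightarrow> real" and N :: nat and U G :: "'a set" and D \<eta> :: real
  assumes "ifs N S r"
    and "feasible_open_set N S U"
    and "D = similarity_dimension N r"
    and "D < DIM('a)"
    and "G = generator N S U"
    and "minkowski_dim (frontier G) G < D"
    and "\<eta> = - (\<Sum>i=1..N. r i powr D * ln (r i))"
  shows "set_integrable lborel {0<..} (\<lambda>\<epsilon>. \<epsilon> powr (D - DIM('a) - 1) * tube_volume G \<epsilon>) \<and>
    tiling_has_average_minkowski_content D (tiling N S U)
      (1 / \<eta> * (LINT \<epsilon>:{0<..}|lborel. \<epsilon> powr (D - DIM('a) - 1) * tube_volume G \<epsilon>)) \<and>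
    (nonlattice N r \<longrightarrow>
      tiling_has_minkowski_content D (tiling N S U)
        (1 / \<eta> * (LINT \<epsilon>:{0<..}|lborel. \<epsilon> powr (D - DIM('a) - 1) * tube_volume G \<epsilon>)))"
proof -
  define T where "T = \<Union>(tiling N S U)"
  define q where "q = D - DIM('a)"
  have "q < 0" using assms(4) by (simp add: q_def)
  have U: "open U" "bounded U" and SU: "\<And>i. i \<in> {1..N} \<Longrightarrow> S i ` U \<subseteq> U"
    using assms(2) by (auto simp: feasible_open_set_def)
  have G: "open G" "bounded G"
    unfolding assms(5) using open_generator[OF assms(1) U] bounded_subset[OF U(2), of "generator N S U"]
    by (auto simp: generator_def)
  have T: "open T" "bounded T"
    unfolding T_def using open_Union_tiling[OF assms(1) U] bounded_subset[OF U(2) Union_tiling_subset[OF SU]]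
    by auto
  have r: "0 < r i" "r i < 1" if "i \<in> {1..N}" for i
    using assms(1) that by (auto simp: ifs_def contracting_similarity_def)
  obtain e u where eu: "0 < e" "0 < u" "\<And>v. 0 < v \<Longrightarrow> v < u \<Longrightarrow> tube_volume G v \<le> v powr (e - q)"
    using tube_volume_small_if_minkowski_dim_less[OF G assms(6)] unfolding q_def by blast
  interpret self_similar_volume "{1..N}" r D "tube_volume T" "measure lborel T" "tube_volume G" "measure lborel G" q e u
  proof
    show "(\<Sum>i\<in>{1..N}. r i powr D) = 1"
      using sum_powr_similarity_dimension[OF assms(1)] by (simp add: assms(3))
    show "tube_volume T v = tube_volume G v + (\<Sum>i=1..N. r i powr (D - q) * tube_volume T (v / r i))" if "0 < v" for v
      using tube_volume_tiling[OF assms(1,2), of v] that r(1)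
      by (simp add: T_def assms(5) q_def powr_realpow)
  qed (use r G T eu \<open>q < 0\<close> in \<open>auto simp: mono_tube_volume tube_volume_nonneg tube_volume_le less_imp_neq[THEN not_sym]\<close>)
  have "mean_step = \<eta>"
    unfolding mean_step_def assms(7) by (simp add: sum_negf)
  then have content_value: "1 / \<eta> * (LINT \<epsilon>:{0<..}|lborel. \<epsilon> powr (D - DIM('a) - 1) * tube_volume G \<epsilon>) = limit_value"
    by (simp add: q_def)
  have log_top: "filterlim (\<lambda>v::real. - ln v) at_top (at_right 0)"
    using ln_at_0 by (simp add: filterlim_uminus_at_bot)
  have "set_integrable lborel {0<..} (\<lambda>\<epsilon>. \<epsilon> powr (D - DIM('a) - 1) * tube_volume G \<epsilon>)"
    using set_integrable_generator by (simp add: q_def)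
  moreover have "tiling_has_average_minkowski_content D (tiling N S U) limit_value"
    unfolding tiling_has_average_minkowski_content_def has_average_minkowski_content_def T_def[symmetric]
      measure_parallel_frontier[OF T(2)] q_def[symmetric]
  proof (rule Lim_transform_eventually[OF filterlim_compose[OF average_volume_limit log_top]])
    have "eventually (\<lambda>\<delta>::real. \<delta> < 1) (at_right 0)"
      by (rule eventually_at_right_field[THEN iffD2]) (auto intro: exI[of _ 1])
    with eventually_at_right_less[of "0::real"]
    show "eventually (\<lambda>\<delta>. (log_tail (tube_volume T) q (- ln \<delta>) - log_tail (tube_volume T) q 0) / (- ln \<delta>) =
        1 / \<bar>ln \<delta>\<bar> * (LINT v:{\<delta>..1}|lborel. v powr q * tube_volume T v / v)) (at_right 0)"
    proof eventually_elim
      case (elim \<delta>)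
      then have "\<bar>ln \<delta>\<bar> = - ln \<delta>" by simp
      then show ?case
        using average_window_eq[OF V.bounded_mono_axioms \<open>q < 0\<close> elim] by simp
    qed
  qed
  moreover have "tiling_has_minkowski_content D (tiling N S U) limit_value" if "nonlattice N r"
    unfolding tiling_has_minkowski_content_def has_minkowski_content_def T_def[symmetric]
      measure_parallel_frontier[OF T(2)] q_def[symmetric]
  proof (rule Lim_transform_eventually[OF filterlim_compose[OF volume_limit_nonlattice log_top]])
    show "\<not> discrete (group_closure ((\<lambda>i. ln (r i)) ` {1..N}))"
      using that by (simp add: nonlattice_def)
    show "eventually (\<lambda>v. log_scaled (tube_volume T) q (- ln v) = v powr q * tube_volume T v) (at_right 0)"
      using eventually_at_right_less[of "0::real"]
      by eventually_elim (simp add: log_scaled_def powr_def)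
  qed
  ultimately show ?thesis unfolding content_value by blast
qed

end
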